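(* Let $E$ and $F$ be countable graphs with no sinks and no sources. If the edge shifts $X_E$ and $X_F$ are conjugate, then the complex Leavitt path algebras $L_{\mathbb{C}}(E)$ and $L_{\mathbb{C}}(F)$ are isomorphic.
   Context: Graphs. A countable graph $E=(E^0,E^1,r,s)$ consists of countable sets $E^0$ (vertices), $E^1$ (edges) and range and source maps $r,s:E^1\to E^0$. A vertex $v$ is a sink if $s^{-1}(v)=\emptyset$ and a source if $r^{-1}(v)=\emptyset$. $E^\infty$ is the set of infinite paths $e_1e_2\ldots$ ($e_i\in E^1$, $r(e_i)=s(e_{i+1})$ for all $i$). Edge shifts and conjugacy. For a set $\mathcal{A}$, let $\mathcal{A}^0=\{\vec{0}\}$ ($\vec{0}$ the empty sequence). If $\mathcal{A}$ is infinite, $\Sigma_{\mathcal{A}}:=\mathcal{A}^{\mathbb{N}}\sqcup\bigcup_{k\ge0}\mathcal{A}^k$ with the quotient topology from the map $Q:\mathcal{A}_\infty\times\mathcal{A}_\infty\times\cdots\to\Sigma_{\mathcal{A}}$ that truncates a sequence just before the first occurrence of $\infty$, where $\mathcal{A}_\infty=\mathcal{A}\cup\{\infty\}$ is the one-point compactification of the discrete space $\mathcal{A}$. If $\mathcal{A}$ is finite, $\Sigma_{\mathcal{A}}:=\mathcal{A}^{\mathbb{N}}$ with the product topology. $l(x)$ is the length of $x$, and the shift map $\sigma$ deletes the first entry, with $\sigma(x)=\vec0$ when $l(x)\le1$. For a graph $E$ with no sinks, the edge shift $X_E$ is the closure of $E^\infty$ in $\Sigma_{E^1}$. $X_E$ and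 $X_F$ are conjugate if there is a continuous bijection $\phi:X_E\to X_F$ with $\phi\circ\sigma=\sigma\circ\phi$ and $l(\phi(x))=l(x)$ for all $x$. Leavitt path algebra. For a field $K$, $L_K(E)$ is the universal $K$-algebra generated by a set $\{v:v\in E^0\}$ of pairwise orthogonal idempotents together with a set $\{e,e^*:e\in E^1\}$ satisfying: (1) $s(e)e=er(e)=e$ for all $e\in E^1$; (2) $r(e)e^*=e^*s(e)=e^*$ for all $e\in E^1$; (3) $e^*f=\delta_{e,f}\,r(e)$ for all $e,f\in E^1$; (4) $v=\sum_{\{e\in E^1:s(e)=v\}}ee^*$ whenever $0<|s^{-1}(v)|<\infty$. *)

theory Defs
  imports
    "HOL-Analysis.Analysis"
    "HOL-Library.Extended_Nat"
    "HOL-Library.Poly_Mapping"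
    "Graph_Theory.Digraph"
begin

section \<open>Graphs\<close>

text \<open>
  A graph \<open>(E\<^sup>0, E\<^sup>1, r, s)\<close> is a \<^typ>\<open>('v, 'e) pre_digraph\<close> satisfying \<^const>\<open>wf_digraph\<close>:
  \<^const>\<open>verts\<close> is \<open>E\<^sup>0\<close>, \<^const>\<open>arcs\<close> is \<open>E\<^sup>1\<close>, \<^const>\<open>tail\<close> is the source map \<open>s\<close> and
  \<^const>\<open>head\<close> is the range map \<open>r\<close>.  Loops and parallel edges are allowed.
\<close>

definition countable_graph :: "('v, 'e) pre_digraph \<Rightarrow> bool" where
  "countable_graph E \<longleftrightarrow> wf_digraph E \<and> countable (verts E) \<and> countable (arcs E)"

definition is_sink :: "('v, 'e) pre_digraph \<Rightarrow> 'v \<Rightarrow> bool" where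
  "is_sink E v \<longleftrightarrow> v \<in> verts E \<and> {e \<in> arcs E. tail E e = v} = {}"

definition is_source :: "('v, 'e) pre_digraph \<Rightarrow> 'v \<Rightarrow> bool" where
  "is_source E v \<longleftrightarrow> v \<in> verts E \<and> {e \<in> arcs E. head E e = v} = {}"

definition infinite_paths :: "('v, 'e) pre_digraph \<Rightarrow> (nat \<Rightarrow> 'e) set" where
  "infinite_paths E = {x. \<forall>i. x i \<in> arcs E \<and> head E (x i) = tail E (x (Suc i))}"


section \<open>Full shift spaces over arbitrary alphabets\<close>

text \<open>The element \<open>Fin []\<close> is the empty sequence.\<close>

datatype 'a sequence = Fin "'a list" | Inf "nat \<Rightarrow> 'a"

fun seq_length :: "'a sequence \<Rightarrow> enat" where
  "seq_length (Fin w) = enat (length w)"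
| "seq_length (Inf x) = \<infinity>"

fun shift_map :: "'a sequence \<Rightarrow> 'a sequence" where
  "shift_map (Fin w) = Fin (tl w)"
| "shift_map (Inf x) = Inf (\<lambda>n. x (Suc n))"

definition full_shift :: "'a set \<Rightarrow> 'a sequence set" where
  "full_shift A =
     (if infinite A then Inf ` {x. range x \<subseteq> A} \<union> Fin ` {w. set w \<subseteq> A}
      else Inf ` {x. range x \<subseteq> A})"

text \<open>
  The truncation map \<open>Q\<close>.  The point at infinity of the one-point compactification of the
  alphabet is \<^const>\<open>None\<close>, as in \<^const>\<open>Alexandroff_compactification\<close>.
\<close>

definition truncate_seq :: "(nat \<Rightarrow> 'a option) \<Rightarrow> 'a sequence" where
  "truncate_seq x =
     (if \<exists>n. x n = None
      then Fin (map (\<lambda>i. the (x i)) [0..<(LEAST n. x n = None)])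
      else Inf (\<lambda>i. the (x i)))"

definition quotient_topology :: "'a topology \<Rightarrow> ('a \<Rightarrow> 'b) \<Rightarrow> 'b topology" where
  "quotient_topology X f =
     topology (\<lambda>U. U \<subseteq> f ` topspace X \<and> openin X {x \<in> topspace X. f x \<in> U})"

text \<open>
  For a finite alphabet, \<^const>\<open>Inf\<close> is injective, so the quotient topology is just the product
  topology transported along \<^const>\<open>Inf\<close>.
\<close>

definition full_shift_topology :: "'a set \<Rightarrow> 'a sequence topology" where
  "full_shift_topology A =
     (if infinite A
      then quotient_topology
             (product_topology (\<lambda>_. Alexandroff_compactification (discrete_topology A)) UNIV)
             truncate_seq
      else quotient_topology (product_topology (\<lambda>_. discrete_topology A) UNIV) Inf)"

lemma openin_quotient_topology:
  "openin (quotient_topology X f) U \<longleftrightarrow>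
     U \<subseteq> f ` topspace X \<and> openin X {x \<in> topspace X. f x \<in> U}"
proof -
  have "istopology (\<lambda>U. U \<subseteq> f ` topspace X \<and> openin X {x \<in> topspace X. f x \<in> U})"
    unfolding istopology_def
  proof (intro conjI allI impI)
    fix S T
    assume S: "S \<subseteq> f ` topspace X \<and> openin X {x \<in> topspace X. f x \<in> S}"
      and T: "T \<subseteq> f ` topspace X \<and> openin X {x \<in> topspace X. f x \<in> T}"
    then show "S \<inter> T \<subseteq> f ` topspace X" by auto
    have "{x \<in> topspace X. f x \<in> S \<inter> T}
        = {x \<in> topspace X. f x \<in> S} \<inter> {x \<in> topspace X. f x \<in> T}" by auto
    then show "openin X {x \<in> topspace X. f x \<in> S \<inter> T}" using S T by auto
  next
    fix \<K>
    assume K: "\<forall>K\<in>\<K>. K \<subseteq> f ` topspace X \<and> openin X {x \<in> topspace X. f x \<in> K}"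
    then show "\<Union>\<K> \<subseteq> f ` topspace X" by auto
    have "{x \<in> topspace X. f x \<in> \<Union>\<K>} = (\<Union>K\<in>\<K>. {x \<in> topspace X. f x \<in> K})" by auto
    then show "openin X {x \<in> topspace X. f x \<in> \<Union>\<K>}" using K by auto
  qed
  then show ?thesis
    by (simp add: quotient_topology_def)
qed

lemma topspace_quotient_topology: "topspace (quotient_topology X f) = f ` topspace X"
proof -
  have "{x \<in> topspace X. f x \<in> f ` topspace X} = topspace X" by auto
  then have "openin (quotient_topology X f) (f ` topspace X)"
    by (simp add: openin_quotient_topology)
  then show ?thesis
    by (metis openin_quotient_topology openin_subset openin_topspace subset_antisym)
qed

lemma quotient_map_quotient_topology: "quotient_map X (quotient_topology X f) f"
  unfolding quotient_map_def
  by (auto simp: topspace_quotient_topology openin_quotient_topology)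

lemma topspace_full_shift_topology: "topspace (full_shift_topology A) = full_shift A"
proof (cases "finite A")
  case True
  then show ?thesis
    by (auto simp: full_shift_topology_def full_shift_def topspace_quotient_topology
        PiE_def Pi_def)
next
  case False
  define P where "P = (UNIV :: nat set) \<rightarrow>\<^sub>E insert None (Some ` A)"
  have "topspace (full_shift_topology A) = truncate_seq ` P"
    using False by (simp add: full_shift_topology_def topspace_quotient_topology P_def)
  also have "\<dots> = Inf ` {x. range x \<subseteq> A} \<union> Fin ` {w. set w \<subseteq> A}"
  proof (intro subset_antisym subsetI)
    fix y assume "y \<in> truncate_seq ` P"
    then obtain x where x: "y = truncate_seq x" "\<And>i. x i \<in> insert None (Some ` A)"
      by (auto simp: P_def)
    have *: "the (x i) \<in> A" if "x i \<noteq> None" for i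
    proof -
      from x(2)[of i] that have "x i \<in> Some ` A" by simp
      then obtain a where "x i = Some a" "a \<in> A" by (rule imageE)
      then show ?thesis by simp
    qed
    show "y \<in> Inf ` {x. range x \<subseteq> A} \<union> Fin ` {w. set w \<subseteq> A}"
    proof (cases "\<exists>n. x n = None")
      case True
      have "set (map (\<lambda>i. the (x i)) [0..<(LEAST n. x n = None)]) \<subseteq> A"
      proof
        fix a assume "a \<in> set (map (\<lambda>i. the (x i)) [0..<(LEAST n. x n = None)])"
        then obtain i where i: "i < (LEAST n. x n = None)" "a = the (x i)" by auto
        show "a \<in> A"
          unfolding i(2) by (rule *) (rule not_less_Least[OF i(1)])
      qed
      then show ?thesis
        using True unfolding x(1) truncate_seq_def by auto
    next
      case False
      then have "range (\<lambda>i. the (x i)) \<subseteq> A"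
        using * by blast
      then show ?thesis
        using False unfolding x(1) truncate_seq_def by auto
    qed
  next
    fix y assume "y \<in> Inf ` {x. range x \<subseteq> A} \<union> Fin ` {w. set w \<subseteq> A}"
    then consider x where "y = Inf x" "range x \<subseteq> A" | w where "y = Fin w" "set w \<subseteq> A"
      by auto
    then show "y \<in> truncate_seq ` P"
    proof cases
      case 1
      have "y = truncate_seq (Some \<circ> x)"
        by (simp add: 1 truncate_seq_def)
      moreover have "Some \<circ> x \<in> P"
        using 1 by (auto simp: P_def)
      ultimately show ?thesis by blast
    next
      case 2
      define x where "x i = (if i < length w then Some (w ! i) else None)" for i
      have "(LEAST n. x n = None) = length w"
        by (rule Least_equality) (auto simp: x_def split: if_splits)
      moreover have "\<exists>n. x n = None"
        by (rule exI[of _ "length w"]) (simp add: x_def)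
      ultimately have "y = truncate_seq x"
        by (auto simp: 2 truncate_seq_def x_def intro!: nth_equalityI)
      moreover have "x \<in> P"
        by (auto simp: P_def x_def intro!: imageI subsetD[OF 2(2)])
      ultimately show ?thesis by blast
    qed
  qed
  finally show ?thesis
    using False by (simp add: full_shift_def)
qed


section \<open>Edge shifts and conjugacy\<close>

definition edge_shift :: "('v, 'e) pre_digraph \<Rightarrow> 'e sequence set" where
  "edge_shift E = full_shift_topology (arcs E) closure_of (Inf ` infinite_paths E)"

definition edge_shift_topology :: "('v, 'e) pre_digraph \<Rightarrow> 'e sequence topology" where
  "edge_shift_topology E = subtopology (full_shift_topology (arcs E)) (edge_shift E)"

definition edge_shifts_conjugate ::
    "('v, 'e) pre_digraph \<Rightarrow> ('w, 'f) pre_digraph \<Rightarrow> bool" where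
  "edge_shifts_conjugate E F \<longleftrightarrow>
     (\<exists>\<phi>. continuous_map (edge_shift_topology E) (edge_shift_topology F) \<phi> \<and>
          bij_betw \<phi> (edge_shift E) (edge_shift F) \<and>
          (\<forall>x\<in>edge_shift E. \<phi> (shift_map x) = shift_map (\<phi> x)) \<and>
          (\<forall>x\<in>edge_shift E. seq_length (\<phi> x) = seq_length x))"


section \<open>Algebras over a field\<close>

text \<open>
  Algebras need not have a unit: a Leavitt path algebra is unital only if the graph has finitely
  many vertices.
\<close>

record ('k, 'a) field_algebra =
  alg_carrier :: "'a set"
  alg_add :: "'a \<Rightarrow> 'a \<Rightarrow> 'a"
  alg_mult :: "'a \<Rightarrow> 'a \<Rightarrow> 'a"
  alg_scale :: "'k \<Rightarrow> 'a \<Rightarrow> 'a"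

definition algebra_iso ::
    "('k, 'a) field_algebra \<Rightarrow> ('k, 'b) field_algebra \<Rightarrow> ('a \<Rightarrow> 'b) \<Rightarrow> bool" where
  "algebra_iso A B h \<longleftrightarrow>
     bij_betw h (alg_carrier A) (alg_carrier B) \<and>
     (\<forall>x\<in>alg_carrier A. \<forall>y\<in>alg_carrier A. h (alg_add A x y) = alg_add B (h x) (h y)) \<and>
     (\<forall>x\<in>alg_carrier A. \<forall>y\<in>alg_carrier A. h (alg_mult A x y) = alg_mult B (h x) (h y)) \<and>
     (\<forall>c. \<forall>x\<in>alg_carrier A. h (alg_scale A c x) = alg_scale B c (h x))"

definition algebras_isomorphic ::
    "('k, 'a) field_algebra \<Rightarrow> ('k, 'b) field_algebra \<Rightarrow> bool" where
  "algebras_isomorphic A B \<longleftrightarrow> (\<exists>h. algebra_iso A B h)"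


section \<open>Free algebras\<close>

text \<open>
  The type \<open>'x free_monoid \<Rightarrow>\<^sub>0 'k\<close>, with the convolution product of \<^typ>\<open>'a \<Rightarrow>\<^sub>0 'b\<close>, is the free
  unital algebra on \<open>'x\<close>.
\<close>

datatype 'x free_monoid = Word (letters: "'x list")

instantiation free_monoid :: (type) monoid_add
begin

definition zero_free_monoid :: "'a free_monoid" where
  "0 = Word []"

definition plus_free_monoid :: "'a free_monoid \<Rightarrow> 'a free_monoid \<Rightarrow> 'a free_monoid" where
  "u + v = Word (letters u @ letters v)"

instance
  by standard (simp_all add: zero_free_monoid_def plus_free_monoid_def)

end

definition gen :: "'x \<Rightarrow> 'x free_monoid \<Rightarrow>\<^sub>0 'k::field" where
  "gen x = Poly_Mapping.single (Word [x]) 1"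

definition scale :: "'k::field \<Rightarrow> ('x free_monoid \<Rightarrow>\<^sub>0 'k) \<Rightarrow> ('x free_monoid \<Rightarrow>\<^sub>0 'k)" where
  "scale c f = Poly_Mapping.single 0 c * f"

lemma lookup_scale: "Poly_Mapping.lookup (scale c f) w = c * Poly_Mapping.lookup f w"
  by (simp add: scale_def lookup_mult lookup_single when_mult)

text \<open>The free non-unital algebra on a set of generators: there is no constant term.\<close>

definition free_algebra :: "'x set \<Rightarrow> ('x free_monoid \<Rightarrow>\<^sub>0 'k::field) set" where
  "free_algebra X = {f. \<forall>w\<in>Poly_Mapping.keys f. w \<noteq> 0 \<and> set (letters w) \<subseteq> X}"

inductive_set ideal_generated ::
    "'x set \<Rightarrow> ('x free_monoid \<Rightarrow>\<^sub>0 'k::field) set \<Rightarrow> ('x free_monoid \<Rightarrow>\<^sub>0 'k) set"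
  for X :: "'x set" and R :: "('x free_monoid \<Rightarrow>\<^sub>0 'k) set" where
  base: "f \<in> R \<Longrightarrow> f \<in> ideal_generated X R"
| zero: "0 \<in> ideal_generated X R"
| add: "f \<in> ideal_generated X R \<Longrightarrow> g \<in> ideal_generated X R \<Longrightarrow> f + g \<in> ideal_generated X R"
| scale: "f \<in> ideal_generated X R \<Longrightarrow> scale c f \<in> ideal_generated X R"
| left: "a \<in> free_algebra X \<Longrightarrow> f \<in> ideal_generated X R \<Longrightarrow> a * f \<in> ideal_generated X R"
| right: "a \<in> free_algebra X \<Longrightarrow> f \<in> ideal_generated X R \<Longrightarrow> f * a \<in> ideal_generated X R"

definition ideal_rel ::
    "'x set \<Rightarrow> ('x free_monoid \<Rightarrow>\<^sub>0 'k::field) set \<Rightarrow> (('x free_monoid \<Rightarrow>\<^sub>0 'k) \<times> ('x free_monoid \<Rightarrow>\<^sub>0 'k)) set" where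
  "ideal_rel X R =
     {(f, g). f \<in> free_algebra X \<and> g \<in> free_algebra X \<and> f - g \<in> ideal_generated X R}"

text \<open>
  The universal (non-unital) algebra with generators \<open>X\<close> and relations \<open>f = 0\<close>, for \<open>f \<in> R\<close>.
\<close>

definition presented_algebra ::
    "'x set \<Rightarrow> ('x free_monoid \<Rightarrow>\<^sub>0 'k::field) set \<Rightarrow> ('k, ('x free_monoid \<Rightarrow>\<^sub>0 'k) set) field_algebra" where
  "presented_algebra X R =
     \<lparr> alg_carrier = free_algebra X // ideal_rel X R,
       alg_add = (\<lambda>S T. \<Union>f\<in>S. \<Union>g\<in>T. ideal_rel X R `` {f + g}),
       alg_mult = (\<lambda>S T. \<Union>f\<in>S. \<Union>g\<in>T. ideal_rel X R `` {f * g}),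
       alg_scale = (\<lambda>c S. \<Union>f\<in>S. ideal_rel X R `` {scale c f}) \<rparr>"

lemma free_algebra_add:
  "f \<in> free_algebra X \<Longrightarrow> g \<in> free_algebra X \<Longrightarrow> f + g \<in> free_algebra X"
  using Poly_Mapping.keys_add[of f g] by (force simp: free_algebra_def)

lemma free_algebra_mult:
  "f \<in> free_algebra X \<Longrightarrow> g \<in> free_algebra X \<Longrightarrow> f * g \<in> free_algebra X"
  using Poly_Mapping.keys_mult[of f g]
  by (fastforce simp: free_algebra_def zero_free_monoid_def plus_free_monoid_def free_monoid.expand)

lemma free_algebra_scale: "f \<in> free_algebra X \<Longrightarrow> scale c f \<in> free_algebra X"
  by (auto simp: free_algebra_def in_keys_iff lookup_scale)

lemma ideal_generated_uminus:
  "f \<in> ideal_generated X R \<Longrightarrow> - f \<in> ideal_generated X R"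
proof -
  have "scale (- 1) f = - f"
    by (rule poly_mapping_eqI) (simp add: lookup_scale)
  then show "f \<in> ideal_generated X R \<Longrightarrow> - f \<in> ideal_generated X R"
    using ideal_generated.scale[of f X R "- 1"] by simp
qed

lemma equiv_ideal_rel: "equiv (free_algebra X) (ideal_rel X R)"
proof (rule equivI)
  show "refl_on (free_algebra X) (ideal_rel X R)"
    by (auto simp: refl_on_def ideal_rel_def ideal_generated.zero)
  show "sym (ideal_rel X R)"
    using ideal_generated_uminus by (fastforce simp: sym_def ideal_rel_def)
  show "trans (ideal_rel X R)"
    using ideal_generated.add by (fastforce simp: trans_def ideal_rel_def)
  show "ideal_rel X R \<subseteq> free_algebra X \<times> free_algebra X"
    by (auto simp: ideal_rel_def)
qed

lemma ideal_rel_add: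
  assumes "(f, f') \<in> ideal_rel X R" "(g, g') \<in> ideal_rel X R"
  shows "(f + g, f' + g') \<in> ideal_rel X R"
  using assms ideal_generated.add[of "f - f'" X R "g - g'"]
  by (auto simp: ideal_rel_def free_algebra_add algebra_simps)

lemma ideal_rel_mult:
  assumes "(f, f') \<in> ideal_rel X R" "(g, g') \<in> ideal_rel X R"
  shows "(f * g, f' * g') \<in> ideal_rel X R"
proof -
  have "(f - f') * g + f' * (g - g') \<in> ideal_generated X R"
    using assms by (auto simp: ideal_rel_def intro: ideal_generated.intros)
  then show ?thesis
    using assms by (auto simp: ideal_rel_def free_algebra_mult algebra_simps)
qed

lemma ideal_rel_scale:
  assumes "(f, f') \<in> ideal_rel X R"
  shows "(scale c f, scale c f') \<in> ideal_rel X R"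
proof -
  have "scale c f - scale c f' = scale c (f - f')"
    by (simp add: scale_def algebra_simps)
  then show ?thesis
    using assms by (auto simp: ideal_rel_def free_algebra_scale intro: ideal_generated.scale)
qed

lemma presented_algebra_ops:
  fixes f g :: "'x free_monoid \<Rightarrow>\<^sub>0 'k::field" and R :: "('x free_monoid \<Rightarrow>\<^sub>0 'k) set"
  assumes f: "f \<in> free_algebra X" and g: "g \<in> free_algebra X"
  defines "r \<equiv> ideal_rel X R"
  shows "alg_add (presented_algebra X R) (r `` {f}) (r `` {g}) = r `` {f + g}"
    and "alg_mult (presented_algebra X R) (r `` {f}) (r `` {g}) = r `` {f * g}"
    and "alg_scale (presented_algebra X R) c (r `` {f}) = r `` {scale c f}"
proof -
  have r: "equiv (free_algebra X) r"
    unfolding r_def by (rule equiv_ideal_rel)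
  have "(\<lambda>f g. r `` {f + g}) respects2 r"
    by (auto simp: congruent2_def r_def intro!: equiv_class_eq[OF equiv_ideal_rel] ideal_rel_add)
  from UN_equiv_class2[OF r r this f g]
  show "alg_add (presented_algebra X R) (r `` {f}) (r `` {g}) = r `` {f + g}"
    by (simp add: presented_algebra_def r_def)
  have "(\<lambda>f g. r `` {f * g}) respects2 r"
    by (auto simp: congruent2_def r_def intro!: equiv_class_eq[OF equiv_ideal_rel] ideal_rel_mult)
  from UN_equiv_class2[OF r r this f g]
  show "alg_mult (presented_algebra X R) (r `` {f}) (r `` {g}) = r `` {f * g}"
    by (simp add: presented_algebra_def r_def)
  have "(\<lambda>f. r `` {scale c f}) respects r"
    by (auto simp: congruent_def r_def intro!: equiv_class_eq[OF equiv_ideal_rel] ideal_rel_scale)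
  from UN_equiv_class[OF r this f]
  show "alg_scale (presented_algebra X R) c (r `` {f}) = r `` {scale c f}"
    by (simp add: presented_algebra_def r_def)
qed


section \<open>Leavitt path algebras\<close>

text \<open>\<open>Ghost e\<close> is the generator \<open>e\<^sup>*\<close>.\<close>

datatype ('v, 'e) lpa_gen = Vertex 'v | Edge 'e | Ghost 'e

definition lpa_gens :: "('v, 'e) pre_digraph \<Rightarrow> ('v, 'e) lpa_gen set" where
  "lpa_gens E = Vertex ` verts E \<union> Edge ` arcs E \<union> Ghost ` arcs E"

inductive_set lpa_relators ::
    "('v, 'e) pre_digraph \<Rightarrow> (('v, 'e) lpa_gen free_monoid \<Rightarrow>\<^sub>0 'k::field) set"
  for E :: "('v, 'e) pre_digraph" where
  idempotent:
    "v \<in> verts E \<Longrightarrow> gen (Vertex v) * gen (Vertex v) - gen (Vertex v) \<in> lpa_relators E"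
| orthogonal:
    "v \<in> verts E \<Longrightarrow> w \<in> verts E \<Longrightarrow> v \<noteq> w \<Longrightarrow>
       gen (Vertex v) * gen (Vertex w) \<in> lpa_relators E"
| source_edge:
    "e \<in> arcs E \<Longrightarrow> gen (Vertex (tail E e)) * gen (Edge e) - gen (Edge e) \<in> lpa_relators E"
| edge_range:
    "e \<in> arcs E \<Longrightarrow> gen (Edge e) * gen (Vertex (head E e)) - gen (Edge e) \<in> lpa_relators E"
| range_ghost:
    "e \<in> arcs E \<Longrightarrow> gen (Vertex (head E e)) * gen (Ghost e) - gen (Ghost e) \<in> lpa_relators E"
| ghost_source:
    "e \<in> arcs E \<Longrightarrow> gen (Ghost e) * gen (Vertex (tail E e)) - gen (Ghost e) \<in> lpa_relators E"
| ghost_edge: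
    "e \<in> arcs E \<Longrightarrow> f \<in> arcs E \<Longrightarrow>
       gen (Ghost e) * gen (Edge f) - (if e = f then gen (Vertex (head E e)) else 0)
         \<in> lpa_relators E"
| vertex_sum:
    "v \<in> verts E \<Longrightarrow> finite {e \<in> arcs E. tail E e = v} \<Longrightarrow> {e \<in> arcs E. tail E e = v} \<noteq> {} \<Longrightarrow>
       gen (Vertex v) - (\<Sum>e\<in>{e \<in> arcs E. tail E e = v}. gen (Edge e) * gen (Ghost e))
         \<in> lpa_relators E"

definition leavitt_path_algebra ::
    "('v, 'e) pre_digraph \<Rightarrow> ('k::field, (('v, 'e) lpa_gen free_monoid \<Rightarrow>\<^sub>0 'k) set) field_algebra" where
  "leavitt_path_algebra E = presented_algebra (lpa_gens E) (lpa_relators E)"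

end

theory Submission
  imports Defs
begin

text \<open>
  The algebra \<open>L\<^sub>k(E)\<close> acts on the functions on \<open>E\<^sup>\<infinity> \<times> \<int>\<close>: a vertex restricts to the paths that
  start there, and \<open>e\<close> and \<open>e\<^sup>*\<close> shift a path while moving the integer coordinate by one.  The
  integer coordinate separates degrees and makes the representation faithful.  A conjugacy
  preserves lengths, so it restricts to a shift-commuting bijection \<open>\<theta>\<close> of infinite paths, and it
  remains to see that conjugation by \<open>\<theta>\<close> carries one algebra of operators onto the other.  The
  operator of an edge \<open>f\<close> of \<open>F\<close> becomes multiplication by the indicator of
  \<open>{x. \<theta> x begins with f}\<close> followed by the shift.  By compactness of the edge shift this set is a
  finite Boolean combination of cylinders \<open>Z(w)\<close> with \<open>w\<close> nonempty, whose indicators are the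
  elements \<open>w w\<^sup>*\<close>.  Vertices come for free as \<open>f\<^sup>* f\<close>, since there are no sources.
\<close>

section \<open>Presented algebras\<close>

text \<open>The element of L(E) that matches an edge of F comes out of a compactness argument, so
  there is no formula on which the defining relations of L(F) could be checked conveniently. Instead
  of a map on generators the proof uses a relation between the two free algebras: two elements are
  related if they have the same operator up to \<theta>. This relation respects sums, products and
  scalars for formal reasons, and all defining relations are absorbed into one fact, that an element
  lies in the ideal iff its operator vanishes. That fact is proved by reducing to combinations of
  monomials \<mu> v \<nu>^* and inducting on the length of \<nu>. The obstacle is an infinite
  emitter, where no relation expresses the vertex through its edges. A second obstacle is the
  missing unit: with infinitely many vertices the indicator of the whole path space is not an
  operator of the algebra. Complements are therefore taken below e e^* for one edge e at a time, and
  finitely many e have to suffice. The length of the cylinders may depend on f.\<close>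

lemma poly_mapping_induct [case_names zero single add]:
  fixes f :: "'a \<Rightarrow>\<^sub>0 'k::comm_monoid_add"
  assumes "P 0"
    and "\<And>w c. w \<in> Poly_Mapping.keys f \<Longrightarrow> P (Poly_Mapping.single w c)"
    and "\<And>g h. P g \<Longrightarrow> P h \<Longrightarrow> P (g + h)"
  shows "P f"
proof -
  have "f = (\<Sum>w\<in>Poly_Mapping.keys f. Poly_Mapping.single w (Poly_Mapping.lookup f w))"
    by (rule poly_mapping_eqI) (simp add: lookup_sum lookup_single when_def in_keys_iff)
  also have "P \<dots>"
  proof -
    have "P (\<Sum>w\<in>A. Poly_Mapping.single w (Poly_Mapping.lookup f w))"
      if "finite A" "A \<subseteq> Poly_Mapping.keys f" for A
      using that by (induction A) (auto intro: assms)
    then show ?thesis by simp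
  qed
  finally show ?thesis .
qed

text \<open>Empty paths contribute the factor 1, which the non-unital free algebra does not contain.
  Factors from this larger set are harmless, because the ideals are closed under scalars as
  well.\<close>

definition free_unital_algebra :: "'x set \<Rightarrow> ('x free_monoid \<Rightarrow>\<^sub>0 'k::field) set" where
  "free_unital_algebra X = {f. \<forall>w\<in>Poly_Mapping.keys f. set (letters w) \<subseteq> X}"

lemma free_algebra_subset_unital: "free_algebra X \<subseteq> free_unital_algebra X"
  by (auto simp: free_algebra_def free_unital_algebra_def)

lemma free_unital_algebra_single:
  "set w \<subseteq> X \<Longrightarrow> Poly_Mapping.single (Word w) c \<in> free_unital_algebra X"
  by (auto simp: free_unital_algebra_def in_keys_iff lookup_single when_def)

lemma free_unital_algebra_zero: "0 \<in> free_unital_algebra X"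
  by (simp add: free_unital_algebra_def)

lemma free_unital_algebra_one: "1 \<in> free_unital_algebra X"
  using free_unital_algebra_single[of "[]" X 1]
  by (simp add: zero_free_monoid_def[symmetric])

lemma free_unital_algebra_gen: "x \<in> X \<Longrightarrow> gen x \<in> free_unital_algebra X"
  by (simp add: gen_def free_unital_algebra_single)

lemma free_unital_algebra_add:
  "f \<in> free_unital_algebra X \<Longrightarrow> g \<in> free_unital_algebra X \<Longrightarrow> f + g \<in> free_unital_algebra X"
  using Poly_Mapping.keys_add[of f g] by (force simp: free_unital_algebra_def)

lemma free_unital_algebra_mult:
  "f \<in> free_unital_algebra X \<Longrightarrow> g \<in> free_unital_algebra X \<Longrightarrow> f * g \<in> free_unital_algebra X"
  using Poly_Mapping.keys_mult[of f g]
  by (fastforce simp: free_unital_algebra_def plus_free_monoid_def)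

lemma free_unital_algebra_uminus: "f \<in> free_unital_algebra X \<Longrightarrow> - f \<in> free_unital_algebra X"
  by (auto simp: free_unital_algebra_def in_keys_iff)

lemma free_unital_algebra_diff:
  "f \<in> free_unital_algebra X \<Longrightarrow> g \<in> free_unital_algebra X \<Longrightarrow> f - g \<in> free_unital_algebra X"
  using free_unital_algebra_add[of f X "- g"] by (simp add: free_unital_algebra_uminus)

lemma free_unital_algebra_scale:
  "f \<in> free_unital_algebra X \<Longrightarrow> scale c f \<in> free_unital_algebra X"
  by (auto simp: free_unital_algebra_def in_keys_iff lookup_scale)

lemma free_unital_algebra_sum:
  "(\<And>i. i \<in> A \<Longrightarrow> f i \<in> free_unital_algebra X) \<Longrightarrow> (\<Sum>i\<in>A. f i) \<in> free_unital_algebra X"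
  by (induction A rule: infinite_finite_induct)
    (auto intro: free_unital_algebra_zero free_unital_algebra_add)

lemmas free_unital_algebra_intros =
  free_unital_algebra_zero free_unital_algebra_one free_unital_algebra_gen
  free_unital_algebra_add free_unital_algebra_mult free_unital_algebra_diff
  free_unital_algebra_scale free_unital_algebra_sum

lemma free_algebra_zero: "0 \<in> free_algebra X"
  by (simp add: free_algebra_def)

lemma free_algebra_gen: "x \<in> X \<Longrightarrow> gen x \<in> free_algebra X"
  by (simp add: gen_def free_algebra_def zero_free_monoid_def)

lemma free_algebra_sum:
  "(\<And>i. i \<in> A \<Longrightarrow> f i \<in> free_algebra X) \<Longrightarrow> (\<Sum>i\<in>A. f i) \<in> free_algebra X"
  by (induction A rule: infinite_finite_induct)
    (auto intro: free_algebra_zero free_algebra_add)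

lemma scale_simps:
  shows "scale 1 f = f" "scale 0 f = 0" "scale c 0 = 0"
    and "scale c (f + g) = scale c f + scale c g"
    and "scale c (f - g) = scale c f - scale c g"
    and "scale c (scale d f) = scale (c * d) f"
    and "scale c f * g = scale c (f * g)"
proof -
  show "scale c f * g = scale c (f * g)"
    by (simp add: scale_def mult.assoc)
qed (rule poly_mapping_eqI, simp add: lookup_scale lookup_add lookup_minus algebra_simps)+

lemma scale_uminus_one: "scale (- 1) f = - f"
  by (rule poly_mapping_eqI) (simp add: lookup_scale)

lemma mult_single_scalar:
  "f * Poly_Mapping.single (0::'x free_monoid) c = scale (c::'k::field) f"
proof (induction f rule: poly_mapping_induct)
  case (single w d)
  then show ?case by (simp add: scale_def mult_single mult.commute)
qed (simp_all add: scale_simps distrib_right)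

lemma scale_sum: "scale c (\<Sum>i\<in>A. f i) = (\<Sum>i\<in>A. scale c (f i))"
  by (simp add: scale_def sum_distrib_left)

text \<open>Words grow by one letter on the right, to match the right multiplication of monomials in
  \<open>free_algebra_cspan\<close>. Single letters are the base case, since there is no constant
  term.\<close>

lemma free_algebra_induct [consumes 1, case_names zero gen add mult scale]:
  fixes f :: "'x free_monoid \<Rightarrow>\<^sub>0 'k::field"
  assumes f: "f \<in> free_algebra X"
    and zero: "P 0"
    and gen: "\<And>x. x \<in> X \<Longrightarrow> P (gen x)"
    and add: "\<And>f g. f \<in> free_algebra X \<Longrightarrow> g \<in> free_algebra X \<Longrightarrow> P f \<Longrightarrow> P g \<Longrightarrow> P (f + g)"
    and mult: "\<And>f x. f \<in> free_algebra X \<Longrightarrow> x \<in> X \<Longrightarrow> P f \<Longrightarrow> P (f * gen x)"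
    and scale: "\<And>c f. f \<in> free_algebra X \<Longrightarrow> P f \<Longrightarrow> P (scale c f)"
  shows "P f"
proof -
  have word: "Poly_Mapping.single (Word w) (1::'k) \<in> free_algebra X \<and> P (Poly_Mapping.single (Word w) 1)"
    if "w \<noteq> []" "set w \<subseteq> X" for w
    using that
  proof (induction w rule: rev_nonempty_induct)
    case (single x)
    then show ?case
      using gen[of x] free_algebra_gen[of x X] by (simp add: gen_def)
  next
    case (snoc x w)
    have "Poly_Mapping.single (Word (w @ [x])) 1 = Poly_Mapping.single (Word w) (1::'k) * gen x"
      by (simp add: gen_def mult_single plus_free_monoid_def)
    moreover have "Poly_Mapping.single (Word w) (1::'k) \<in> free_algebra X" "P (Poly_Mapping.single (Word w) 1)"
      "x \<in> X"
      using snoc by auto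
    ultimately show ?case
      by (simp add: mult free_algebra_mult free_algebra_gen)
  qed
  have "f \<in> free_algebra X \<and> P f"
  proof (induction rule: poly_mapping_induct[of "\<lambda>g. g \<in> free_algebra X \<and> P g" f])
    case (single w c)
    obtain l where l: "w = Word l" by (cases w)
    from single f have "l \<noteq> []" "set l \<subseteq> X"
      by (fastforce simp: free_algebra_def l zero_free_monoid_def)+
    note word[OF this]
    moreover have "Poly_Mapping.single w c = scale c (Poly_Mapping.single (Word l) 1)"
      by (simp add: scale_def mult_single l)
    ultimately show ?case
      by (auto intro: scale free_algebra_scale)
  qed (auto intro: zero free_algebra_zero add free_algebra_add)
  then show ?thesis by simp
qed

text \<open>The relation need not be single-valued. Closure under sums and scalars turns
  \<open>ideal\<close> into a statement about differences, whose two directions make the induced map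
  on classes well defined and injective; the totality assumptions give its domain and its
  surjectivity.\<close>

lemma presented_algebras_isomorphic_if_relation:
  fixes X :: "'x set" and Y :: "'y set"
    and R :: "('x free_monoid \<Rightarrow>\<^sub>0 'k::field) set" and S :: "('y free_monoid \<Rightarrow>\<^sub>0 'k) set"
    and \<rho> :: "('x free_monoid \<Rightarrow>\<^sub>0 'k) \<Rightarrow> ('y free_monoid \<Rightarrow>\<^sub>0 'k) \<Rightarrow> bool"
  assumes dom: "\<And>f g. \<rho> f g \<Longrightarrow> f \<in> free_algebra X \<and> g \<in> free_algebra Y"
    and left_total: "\<And>f. f \<in> free_algebra X \<Longrightarrow> \<exists>g. \<rho> f g"
    and right_total: "\<And>g. g \<in> free_algebra Y \<Longrightarrow> \<exists>f. \<rho> f g"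
    and add: "\<And>f g f' g'. \<rho> f g \<Longrightarrow> \<rho> f' g' \<Longrightarrow> \<rho> (f + f') (g + g')"
    and mult: "\<And>f g f' g'. \<rho> f g \<Longrightarrow> \<rho> f' g' \<Longrightarrow> \<rho> (f * f') (g * g')"
    and scale: "\<And>f g c. \<rho> f g \<Longrightarrow> \<rho> (scale c f) (scale c g)"
    and ideal: "\<And>f g. \<rho> f g \<Longrightarrow> f \<in> ideal_generated X R \<longleftrightarrow> g \<in> ideal_generated Y S"
  shows "algebras_isomorphic (presented_algebra X R) (presented_algebra Y S)"
proof -
  let ?r = "ideal_rel X R" and ?s = "ideal_rel Y S"
  \<comment> \<open>The choices of a representative in C and of a partner for it do not matter, by
    \<open>class_eq\<close>.\<close>
  define h where "h C = ?s `` {SOME g. \<exists>f\<in>C. \<rho> f g}" for C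
  have diff: "f - f' \<in> ideal_generated X R \<longleftrightarrow> g - g' \<in> ideal_generated Y S"
    if "\<rho> f g" "\<rho> f' g'" for f f' g g'
    using ideal[OF add[OF that(1) scale[OF that(2), of "- 1"]]] by (simp add: scale_uminus_one)
  have class_eq: "?r `` {f} = ?r `` {f'} \<longleftrightarrow> ?s `` {g} = ?s `` {g'}"
    if "\<rho> f g" "\<rho> f' g'" for f f' g g'
  proof -
    have "?r `` {f} = ?r `` {f'} \<longleftrightarrow> (f, f') \<in> ?r" "?s `` {g} = ?s `` {g'} \<longleftrightarrow> (g, g') \<in> ?s"
      using dom[OF that(1)] dom[OF that(2)]
      by (auto intro!: eq_equiv_class_iff[OF equiv_ideal_rel])
    then show ?thesis
      using diff[OF that] dom[OF that(1)] dom[OF that(2)] by (simp add: ideal_rel_def)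
  qed
  have h: "h (?r `` {f}) = ?s `` {g}" if "\<rho> f g" for f g
  proof -
    have "f \<in> ?r `` {f}"
      using dom[OF that] by (simp add: ideal_rel_def ideal_generated.zero)
    then have "\<exists>g. \<exists>f'\<in>?r `` {f}. \<rho> f' g"
      using that by blast
    from someI_ex[OF this] obtain f' where f': "f' \<in> ?r `` {f}"
      and \<rho>: "\<rho> f' (SOME g. \<exists>f'\<in>?r `` {f}. \<rho> f' g)" by blast
    have "?r `` {f} = ?r `` {f'}"
      using f' by (intro equiv_class_eq[OF equiv_ideal_rel]) simp
    then show ?thesis
      unfolding h_def using class_eq[OF that \<rho>] by simp
  qed
  have carX: "alg_carrier (presented_algebra X R) = (\<lambda>f. ?r `` {f}) ` free_algebra X"
    and carY: "alg_carrier (presented_algebra Y S) = (\<lambda>f. ?s `` {f}) ` free_algebra Y"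
    by (auto simp: presented_algebra_def quotient_def)
  have "algebra_iso (presented_algebra X R) (presented_algebra Y S) h"
    unfolding algebra_iso_def
  proof (intro conjI ballI allI)
    show "bij_betw h (alg_carrier (presented_algebra X R)) (alg_carrier (presented_algebra Y S))"
      unfolding bij_betw_def
    proof (intro conjI inj_onI)
      fix A B
      assume "A \<in> alg_carrier (presented_algebra X R)" "B \<in> alg_carrier (presented_algebra X R)"
        and eq: "h A = h B"
      then obtain f f' where f: "A = ?r `` {f}" "B = ?r `` {f'}"
        "f \<in> free_algebra X" "f' \<in> free_algebra X" unfolding carX by blast
      then obtain g g' where g: "\<rho> f g" "\<rho> f' g'" using left_total by meson
      have "?s `` {g} = ?s `` {g'}"
        using eq by (simp only: f(1,2) h[OF g(1)] h[OF g(2)])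
      then show "A = B"
        by (simp only: f(1,2) class_eq[OF g])
    next
      show "h ` alg_carrier (presented_algebra X R) = alg_carrier (presented_algebra Y S)"
      proof (intro subset_antisym subsetI)
        fix B assume "B \<in> h ` alg_carrier (presented_algebra X R)"
        then obtain f where f: "f \<in> free_algebra X" "B = h (?r `` {f})" unfolding carX by blast
        then obtain g where g: "\<rho> f g" using left_total by meson
        show "B \<in> alg_carrier (presented_algebra Y S)"
          using dom[OF g] unfolding f h[OF g] carY by blast
      next
        fix B assume "B \<in> alg_carrier (presented_algebra Y S)"
        then obtain g where g: "g \<in> free_algebra Y" "B = ?s `` {g}" unfolding carY by blast
        then obtain f where f: "\<rho> f g" using right_total by meson
        show "B \<in> h ` alg_carrier (presented_algebra X R)"
          using dom[OF f] unfolding g h[OF f, symmetric] carX by blast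
      qed
    qed
  next
    fix A B
    assume "A \<in> alg_carrier (presented_algebra X R)" "B \<in> alg_carrier (presented_algebra X R)"
    then obtain f f' where f: "A = ?r `` {f}" "B = ?r `` {f'}"
      "f \<in> free_algebra X" "f' \<in> free_algebra X" unfolding carX by blast
    then obtain g g' where g: "\<rho> f g" "\<rho> f' g'" using left_total by meson
    show "h (alg_add (presented_algebra X R) A B) = alg_add (presented_algebra Y S) (h A) (h B)"
      using dom[OF g(1)] dom[OF g(2)]
      by (simp add: f presented_algebra_ops h[OF g(1)] h[OF g(2)] h[OF add[OF g]])
    show "h (alg_mult (presented_algebra X R) A B) = alg_mult (presented_algebra Y S) (h A) (h B)"
      using dom[OF g(1)] dom[OF g(2)]
      by (simp add: f presented_algebra_ops h[OF g(1)] h[OF g(2)] h[OF mult[OF g]])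
  next
    fix c A
    assume "A \<in> alg_carrier (presented_algebra X R)"
    then obtain f where f: "A = ?r `` {f}" "f \<in> free_algebra X" unfolding carX by blast
    then obtain g where g: "\<rho> f g" using left_total by meson
    show "h (alg_scale (presented_algebra X R) c A) = alg_scale (presented_algebra Y S) c (h A)"
      using dom[OF g] f(2)
      by (simp add: f(1) presented_algebra_ops(3)[of f _ f] presented_algebra_ops(3)[of g _ g]
          h[OF g] h[OF scale[OF g]])
  qed
  then show ?thesis
    unfolding algebras_isomorphic_def by blast
qed

text \<open>The constant term of a acts through closure under scalars, and the rest of a lies in the
  non-unital free algebra.\<close>

lemma ideal_generated_mult_left:
  assumes a: "a \<in> free_unital_algebra X" and f: "f \<in> ideal_generated X R"
  shows "a * f \<in> ideal_generated X R"
proof -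
  let ?c = "Poly_Mapping.lookup a 0"
  let ?b = "a - Poly_Mapping.single 0 ?c"
  have "?b \<in> free_algebra X"
    using a by (auto simp: free_algebra_def free_unital_algebra_def in_keys_iff lookup_minus
        lookup_single when_def split: if_splits)
  then have "scale ?c f + ?b * f \<in> ideal_generated X R"
    using f by (intro ideal_generated.add ideal_generated.scale ideal_generated.left ideal_generated.right)
  moreover have "scale ?c f + ?b * f = a * f"
    by (simp add: scale_def algebra_simps)
  ultimately show ?thesis by simp
qed

lemma ideal_generated_mult_right:
  assumes a: "a \<in> free_unital_algebra X" and f: "f \<in> ideal_generated X R"
  shows "f * a \<in> ideal_generated X R"
proof -
  let ?c = "Poly_Mapping.lookup a 0"
  let ?b = "a - Poly_Mapping.single 0 ?c"
  have "?b \<in> free_algebra X"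
    using a by (auto simp: free_algebra_def free_unital_algebra_def in_keys_iff lookup_minus
        lookup_single when_def split: if_splits)
  then have "scale ?c f + f * ?b \<in> ideal_generated X R"
    using f by (intro ideal_generated.add ideal_generated.scale ideal_generated.left ideal_generated.right)
  moreover have "scale ?c f + f * ?b = f * a"
    by (simp add: mult_single_scalar[symmetric] algebra_simps)
  ultimately show ?thesis by simp
qed

lemma ideal_generated_diff:
  "f \<in> ideal_generated X R \<Longrightarrow> g \<in> ideal_generated X R \<Longrightarrow> f - g \<in> ideal_generated X R"
  using ideal_generated.add[OF _ ideal_generated_uminus] by fastforce

lemma ideal_generated_sum:
  "(\<And>i. i \<in> A \<Longrightarrow> f i \<in> ideal_generated X R) \<Longrightarrow> (\<Sum>i\<in>A. f i) \<in> ideal_generated X R"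
  by (induction A rule: infinite_finite_induct) (auto intro: ideal_generated.intros)

lemma ideal_generated_subset_unital:
  assumes "R \<subseteq> free_unital_algebra X"
  shows "ideal_generated X R \<subseteq> free_unital_algebra X"
proof
  fix f assume "f \<in> ideal_generated X R"
  then show "f \<in> free_unital_algebra X"
    by induction (use assms free_algebra_subset_unital[of X] in
        \<open>auto intro: free_unital_algebra_intros\<close>)
qed

section \<open>Representations on functions\<close>

definition linear_op :: "(('p \<Rightarrow> 'k::field) \<Rightarrow> 'p \<Rightarrow> 'k) \<Rightarrow> bool" where
  "linear_op T \<longleftrightarrow>
     (\<forall>\<xi> \<eta>. T (\<lambda>p. \<xi> p + \<eta> p) = (\<lambda>p. T \<xi> p + T \<eta> p)) \<and>
     (\<forall>c \<xi>. T (\<lambda>p. c * \<xi> p) = (\<lambda>p. c * T \<xi> p))"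

definition rep :: "('x \<Rightarrow> ('p \<Rightarrow> 'k) \<Rightarrow> 'p \<Rightarrow> 'k) \<Rightarrow> ('x free_monoid \<Rightarrow>\<^sub>0 'k::field) \<Rightarrow> ('p \<Rightarrow> 'k) \<Rightarrow> 'p \<Rightarrow> 'k"
  where "rep op f \<xi> p =
    (\<Sum>w\<in>Poly_Mapping.keys f. Poly_Mapping.lookup f w * foldr op (letters w) \<xi> p)"

lemma rep_superset:
  assumes "finite A" "Poly_Mapping.keys f \<subseteq> A"
  shows "rep op f \<xi> p = (\<Sum>w\<in>A. Poly_Mapping.lookup f w * foldr op (letters w) \<xi> p)"
  unfolding rep_def using assms by (intro sum.mono_neutral_left) (auto simp: in_keys_iff)

lemma rep_zero [simp]: "rep op 0 \<xi> = (\<lambda>p. 0)"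
  by (rule ext) (simp add: rep_def)

lemma rep_single: "rep op (Poly_Mapping.single w c) \<xi> = (\<lambda>p. c * foldr op (letters w) \<xi> p)"
  by (rule ext, subst rep_superset[of "{w}"]) auto

lemma rep_gen [simp]: "rep op (gen x) = op x"
  by (rule ext) (simp add: gen_def rep_single)

lemma rep_add [simp]: "rep op (f + g) \<xi> = (\<lambda>p. rep op f \<xi> p + rep op g \<xi> p)"
proof
  fix p
  let ?A = "Poly_Mapping.keys f \<union> Poly_Mapping.keys g"
  have "Poly_Mapping.keys (f + g) \<subseteq> ?A" by (rule Poly_Mapping.keys_add)
  then show "rep op (f + g) \<xi> p = rep op f \<xi> p + rep op g \<xi> p"
    by (simp add: rep_superset[of ?A] lookup_add algebra_simps sum.distrib)
qed

lemma rep_scale [simp]: "rep op (scale c f) \<xi> = (\<lambda>p. c * rep op f \<xi> p)"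
proof
  fix p
  have "Poly_Mapping.keys (scale c f) \<subseteq> Poly_Mapping.keys f"
    by (auto simp: in_keys_iff lookup_scale)
  then show "rep op (scale c f) \<xi> p = c * rep op f \<xi> p"
    by (simp add: rep_superset[of "Poly_Mapping.keys f"] lookup_scale sum_distrib_left mult.assoc)
qed

lemma rep_uminus [simp]: "rep op (- f) \<xi> = (\<lambda>p. - rep op f \<xi> p)"
  using rep_scale[of op "- 1" f] by (simp add: scale_uminus_one)

lemma rep_diff [simp]: "rep op (f - g) \<xi> = (\<lambda>p. rep op f \<xi> p - rep op g \<xi> p)"
  using rep_add[of op f "- g"] by simp

lemma rep_sum [simp]: "rep op (\<Sum>i\<in>A. f i) \<xi> = (\<lambda>p. \<Sum>i\<in>A. rep op (f i) \<xi> p)"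
  by (induction A rule: infinite_finite_induct) auto

lemma linear_op_foldr: "(\<And>x. linear_op (op x)) \<Longrightarrow> linear_op (foldr op w)"
  by (induction w) (auto simp: linear_op_def)

lemma linear_op_rep:
  assumes "\<And>x. linear_op (op x)"
  shows "linear_op (rep op f)"
proof -
  have add: "foldr op w (\<lambda>p. \<xi> p + \<eta> p) = (\<lambda>p. foldr op w \<xi> p + foldr op w \<eta> p)"
    and mult: "foldr op w (\<lambda>p. c * \<xi> p) = (\<lambda>p. c * foldr op w \<xi> p)" for w \<xi> \<eta> c
    using linear_op_foldr[of op w] assms by (simp_all add: linear_op_def)
  show ?thesis
    unfolding linear_op_def rep_def
    by (intro conjI allI ext)
      (simp_all only: add mult distrib_left sum.distrib sum_distrib_left mult.left_commute)
qed

lemma linear_op_zero: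
  assumes "linear_op T"
  shows "T (\<lambda>p. 0) = (\<lambda>p. 0)"
proof -
  have "T (\<lambda>p. 0 * 0) = (\<lambda>p. 0 * T (\<lambda>p. 0) p)"
    using assms unfolding linear_op_def by (elim conjE allE)
  then show ?thesis by simp
qed

lemma rep_mult:
  assumes lin: "\<And>x. linear_op (op x)"
  shows "rep op (f * g) \<xi> = rep op f (rep op g \<xi>)"
proof (induction f rule: poly_mapping_induct)
  case zero
  then show ?case by simp
next
  case (single u c)
  show ?case
  proof (induction g rule: poly_mapping_induct)
    case zero
    then show ?case
      using linear_op_zero[OF linear_op_rep[of op, OF lin]] by simp
  next
    case (single v d)
    show ?case
      using linear_op_foldr[of op "letters u", OF lin]
      by (simp add: mult_single rep_single plus_free_monoid_def linear_op_def mult.assoc)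
  next
    case (add g h)
    then show ?case
      using linear_op_rep[of op "Poly_Mapping.single u c", OF lin]
      by (simp add: distrib_left linear_op_def)
  qed
next
  case (add f g)
  then show ?case by (simp add: distrib_right)
qed

lemma rep_ideal_generated:
  assumes lin: "\<And>x. linear_op (op x)"
    and R: "\<And>f \<xi>. f \<in> R \<Longrightarrow> rep op f \<xi> = (\<lambda>p. 0)"
    and f: "f \<in> ideal_generated X R"
  shows "rep op f \<xi> = (\<lambda>p. 0)"
  using f
proof (induction arbitrary: \<xi>)
  case (left a f)
  then show ?case
    using linear_op_zero[OF linear_op_rep[of op, OF lin]] by (simp add: rep_mult[OF lin])
next
  case (right a f)
  then show ?case by (simp add: rep_mult[OF lin])
qed (auto simp: R)

section \<open>The path representation\<close>

text \<open>On point masses, \<open>Edge e\<close> takes (x, n) to (e x, n + 1), and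
  \<open>Ghost e\<close> removes a leading e and lowers n. The guards confine everything to infinite
  paths, since the underlying type contains all sequences.\<close>

fun lpa_op :: "('v, 'e) pre_digraph \<Rightarrow> ('v, 'e) lpa_gen \<Rightarrow>
    ((nat \<Rightarrow> 'e) \<times> int \<Rightarrow> 'k::field) \<Rightarrow> (nat \<Rightarrow> 'e) \<times> int \<Rightarrow> 'k" where
  "lpa_op E (Vertex v) \<xi> (x, n) = (if x \<in> infinite_paths E \<and> tail E (x 0) = v then \<xi> (x, n) else 0)"
| "lpa_op E (Edge e) \<xi> (x, n) =
     (if x \<in> infinite_paths E \<and> x 0 = e then \<xi> (\<lambda>i. x (Suc i), n - 1) else 0)"
| "lpa_op E (Ghost e) \<xi> (x, n) =
     (if case_nat e x \<in> infinite_paths E then \<xi> (case_nat e x, n + 1) else 0)"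

abbreviation "lpa_rep E \<equiv> rep (lpa_op E)"

lemma linear_op_lpa_op: "linear_op (lpa_op E x)"
  unfolding linear_op_def
  by (intro conjI allI ext; rename_tac p; case_tac p; cases x) (auto simp: algebra_simps)

lemmas lpa_rep_mult = rep_mult[of "lpa_op _", OF linear_op_lpa_op]

lemma case_nat_shift [simp]: "case_nat (x 0) (\<lambda>i. x (Suc i)) = x"
  by (rule ext) (simp split: nat.split)

lemma case_nat_eq_iff: "case_nat a x = y \<longleftrightarrow> a = y 0 \<and> x = (\<lambda>i. y (Suc i))"
  by auto

lemma infinite_paths_case_nat:
  "case_nat e x \<in> infinite_paths E \<longleftrightarrow>
     e \<in> arcs E \<and> x \<in> infinite_paths E \<and> head E e = tail E (x 0)"
proof -
  have all: "(\<forall>i. P i) \<longleftrightarrow> P 0 \<and> (\<forall>i. P (Suc i))" for P :: "nat \<Rightarrow> bool"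
    by (metis not0_implies_Suc)
  show ?thesis
    unfolding infinite_paths_def mem_Collect_eq by (subst all) auto
qed

lemma infinite_paths_shift: "x \<in> infinite_paths E \<Longrightarrow> (\<lambda>i. x (Suc i)) \<in> infinite_paths E"
  by (simp add: infinite_paths_def)

lemma lpa_rep_relators:
  assumes "f \<in> lpa_relators E"
  shows "lpa_rep E f \<xi> = (\<lambda>p. 0)"
proof
  fix p :: "(nat \<Rightarrow> 'b) \<times> int"
  obtain x n where p: "p = (x, n)" by (cases p)
  have arcs: "x 0 \<in> arcs E" and step: "head E (x 0) = tail E (x (Suc 0))"
    if "x \<in> infinite_paths E"
    using that by (auto simp: infinite_paths_def)
  show "lpa_rep E f \<xi> p = 0"
    using assms
  proof cases
    case (vertex_sum v)
    let ?A = "{e \<in> arcs E. tail E e = v}"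
    \<comment> \<open>At (x, n) only the summand of the first edge of x survives.\<close>
    have "lpa_rep E (gen (Edge e) * gen (Ghost e)) \<xi> (x, n) =
        (if e = x 0 then (if x \<in> infinite_paths E then \<xi> (x, n) else 0) else 0)" for e
      by (auto simp: lpa_rep_mult)
    then show ?thesis
      using arcs vertex_sum by (simp add: p sum.delta)
  qed (use step in \<open>auto simp: p lpa_rep_mult infinite_paths_shift infinite_paths_case_nat\<close>)
qed

lemma lpa_rep_ideal:
  "f \<in> ideal_generated (lpa_gens E) (lpa_relators E) \<Longrightarrow> lpa_rep E f \<xi> = (\<lambda>p. 0)"
  using rep_ideal_generated[of "lpa_op E", OF linear_op_lpa_op lpa_rep_relators] by blast

text \<open>Every word of f is nonempty, and its first letter is the outermost operator, whose guard
  fails at x. A constant term would break this.\<close>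

lemma lpa_rep_off_paths:
  fixes f :: "_ \<Rightarrow>\<^sub>0 'k::field"
  assumes "f \<in> free_algebra X" "x \<notin> infinite_paths E"
  shows "lpa_rep E f \<xi> (x, n) = 0"
proof -
  have op: "lpa_op E g \<eta> (x, n) = 0" for g and \<eta> :: "_ \<Rightarrow> 'k"
    using assms(2) by (cases g) (auto simp: infinite_paths_case_nat)
  have "foldr (lpa_op E) (letters w) \<xi> (x, n) = 0" if "w \<in> Poly_Mapping.keys f" for w
  proof -
    have "w \<noteq> 0" using assms(1) that by (auto simp: free_algebra_def)
    then obtain g l where "letters w = g # l"
      by (cases w; cases "letters w") (auto simp: zero_free_monoid_def)
    then show ?thesis by (simp add: op)
  qed
  then show ?thesis by (simp add: rep_def)
qed

section \<open>Faithfulness of the path representation\<close>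

text \<open>Without sinks every vertex starts an infinite path, so the path representation does not
  kill any vertex.\<close>

locale sinkless_graph =
  fixes E :: "('v, 'e) pre_digraph"
  assumes wf: "wf_digraph E"
    and out_edge: "v \<in> verts E \<Longrightarrow> \<exists>e\<in>arcs E. tail E e = v"
begin

lemma in_verts [simp]: "e \<in> arcs E \<Longrightarrow> tail E e \<in> verts E" "e \<in> arcs E \<Longrightarrow> head E e \<in> verts E"
  using wf by (auto simp: wf_digraph_def)

lemma infinite_path_from:
  assumes "v \<in> verts E"
  obtains x where "x \<in> infinite_paths E" "tail E (x 0) = v"
proof -
  obtain e where e: "e \<in> arcs E" "tail E e = v" using out_edge[OF assms] by blast
  define nxt where "nxt f = (SOME g. g \<in> arcs E \<and> tail E g = head E f)" for f
  have nxt: "nxt f \<in> arcs E \<and> tail E (nxt f) = head E f" if "f \<in> arcs E" for f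
  proof -
    have "\<exists>g. g \<in> arcs E \<and> tail E g = head E f" using out_edge[of "head E f"] that by auto
    then show ?thesis unfolding nxt_def by (rule someI_ex)
  qed
  define x where "x n = (nxt ^^ n) e" for n
  have "x n \<in> arcs E" for n
    by (induction n) (auto simp: x_def e nxt)
  with nxt have "x \<in> infinite_paths E"
    by (simp add: infinite_paths_def) (simp add: x_def)
  then show thesis by (rule that) (simp add: x_def e)
qed

section \<open>Calculation modulo the defining relations\<close>

abbreviation gens :: "('v, 'e) lpa_gen set" where "gens \<equiv> lpa_gens E"

abbreviation free1 :: "(('v, 'e) lpa_gen free_monoid \<Rightarrow>\<^sub>0 'k::field) set" where
  "free1 \<equiv> free_unital_algebra gens"

abbreviation rels :: "(('v, 'e) lpa_gen free_monoid \<Rightarrow>\<^sub>0 'k::field) set" where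
  "rels \<equiv> ideal_generated gens (lpa_relators E)"

text \<open>Calculations take place in the free algebra modulo the ideal, because there the ring
  laws come with the type.\<close>

definition lcong :: "(('v, 'e) lpa_gen free_monoid \<Rightarrow>\<^sub>0 'k::field) \<Rightarrow>
    (('v, 'e) lpa_gen free_monoid \<Rightarrow>\<^sub>0 'k) \<Rightarrow> bool" (infix "\<simeq>" 50) where
  "f \<simeq> g \<longleftrightarrow> f - g \<in> rels"

abbreviation V :: "'v \<Rightarrow> ('v, 'e) lpa_gen free_monoid \<Rightarrow>\<^sub>0 'k::field" where "V v \<equiv> gen (Vertex v)"
abbreviation D :: "'e \<Rightarrow> ('v, 'e) lpa_gen free_monoid \<Rightarrow>\<^sub>0 'k::field" where "D e \<equiv> gen (Edge e)"
abbreviation H :: "'e \<Rightarrow> ('v, 'e) lpa_gen free_monoid \<Rightarrow>\<^sub>0 'k::field" where "H e \<equiv> gen (Ghost e)"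

lemma V_free1 [simp]: "v \<in> verts E \<Longrightarrow> V v \<in> free1"
  and D_free1 [simp]: "e \<in> arcs E \<Longrightarrow> D e \<in> free1"
  and H_free1 [simp]: "e \<in> arcs E \<Longrightarrow> H e \<in> free1"
  by (auto simp: lpa_gens_def intro!: free_unital_algebra_gen)

lemma lcong_refl [simp, intro]: "f \<simeq> f"
  by (simp add: lcong_def ideal_generated.zero)

lemma lcong_sym: "f \<simeq> g \<Longrightarrow> g \<simeq> f"
  using ideal_generated_uminus by (fastforce simp: lcong_def)

lemma lcong_trans [trans]: "f \<simeq> g \<Longrightarrow> g \<simeq> h \<Longrightarrow> f \<simeq> h"
  using ideal_generated.add by (fastforce simp: lcong_def)

lemma lcong_zero: "f \<simeq> 0 \<longleftrightarrow> f \<in> rels"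
  by (simp add: lcong_def)

lemma lcong_add: "f \<simeq> g \<Longrightarrow> f' \<simeq> g' \<Longrightarrow> f + f' \<simeq> g + g'"
  unfolding lcong_def using ideal_generated.add[of "f - g" _ _ "f' - g'"] by (simp add: algebra_simps)

lemma lcong_scale: "f \<simeq> g \<Longrightarrow> scale c f \<simeq> scale c g"
  unfolding lcong_def scale_simps(5)[symmetric] by (rule ideal_generated.scale)

lemma lcong_sum: "(\<And>i. i \<in> A \<Longrightarrow> f i \<simeq> g i) \<Longrightarrow> sum f A \<simeq> sum g A"
  unfolding lcong_def sum_subtractf[symmetric] by (rule ideal_generated_sum)

lemma lcong_left: "f \<simeq> g \<Longrightarrow> a \<in> free1 \<Longrightarrow> a * f \<simeq> a * g"
  unfolding lcong_def right_diff_distrib[symmetric] by (rule ideal_generated_mult_left)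

lemma lcong_right: "f \<simeq> g \<Longrightarrow> a \<in> free1 \<Longrightarrow> f * a \<simeq> g * a"
  unfolding lcong_def left_diff_distrib[symmetric] by (rule ideal_generated_mult_right)

lemma lcong_in_rels: "f \<simeq> g \<Longrightarrow> g \<in> rels \<Longrightarrow> f \<in> rels"
  unfolding lcong_zero[symmetric] by (rule lcong_trans)

lemma lpa_relators_free1: "lpa_relators E \<subseteq> (free1 :: (_ \<Rightarrow>\<^sub>0 'k::field) set)"
proof
  fix f :: "_ \<Rightarrow>\<^sub>0 'k" assume "f \<in> lpa_relators E"
  then show "f \<in> free1"
    by cases (auto intro!: free_unital_algebra_intros(4-) free_unital_algebra_zero split: if_splits)
qed

lemmas rels_free1 = ideal_generated_subset_unital[OF lpa_relators_free1]

lemma relator_lcong: "f - g \<in> lpa_relators E \<Longrightarrow> f \<simeq> g"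
  unfolding lcong_def by (rule ideal_generated.base)

lemma VV: "v \<in> verts E \<Longrightarrow> w \<in> verts E \<Longrightarrow> V v * V w \<simeq> (if v = w then V v else 0)"
  by (auto intro!: relator_lcong lpa_relators.intros)

text \<open>The relators only treat v = s(e). For another v, insert s(e) in front of e and use
  orthogonality of vertices; \<open>DV\<close>, \<open>VH\<close> and \<open>HV\<close> follow the
  same pattern.\<close>

lemma VD:
  assumes "v \<in> verts E" "e \<in> arcs E"
  shows "V v * D e \<simeq> (if v = tail E e then D e else 0)"
proof -
  have *: "V (tail E e) * D e \<simeq> D e"
    using assms by (intro relator_lcong lpa_relators.intros)
  have "V v * D e \<simeq> V v * (V (tail E e) * D e)"
    using assms by (intro lcong_left lcong_sym[OF *]) simp
  also have "\<dots> = (V v * V (tail E e)) * D e" by (simp add: mult.assoc)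
  also have "\<dots> \<simeq> (if v = tail E e then V v else 0) * D e"
    using assms by (intro lcong_right VV) auto
  also have "\<dots> \<simeq> (if v = tail E e then D e else 0)"
    using * by auto
  finally show ?thesis .
qed

lemma DV:
  assumes "v \<in> verts E" "e \<in> arcs E"
  shows "D e * V v \<simeq> (if v = head E e then D e else 0)"
proof -
  have *: "D e * V (head E e) \<simeq> D e"
    using assms by (intro relator_lcong lpa_relators.intros)
  have "D e * V v \<simeq> (D e * V (head E e)) * V v"
    using assms by (intro lcong_right lcong_sym[OF *]) simp
  also have "\<dots> = D e * (V (head E e) * V v)" by (simp add: mult.assoc)
  also have "\<dots> \<simeq> D e * (if head E e = v then V (head E e) else 0)"
    using assms by (intro lcong_left VV) auto
  also have "\<dots> \<simeq> (if v = head E e then D e else 0)"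
    using * by auto
  finally show ?thesis .
qed

lemma VH:
  assumes "v \<in> verts E" "e \<in> arcs E"
  shows "V v * H e \<simeq> (if v = head E e then H e else 0)"
proof -
  have *: "V (head E e) * H e \<simeq> H e"
    using assms by (intro relator_lcong lpa_relators.intros)
  have "V v * H e \<simeq> V v * (V (head E e) * H e)"
    using assms by (intro lcong_left lcong_sym[OF *]) simp
  also have "\<dots> = (V v * V (head E e)) * H e" by (simp add: mult.assoc)
  also have "\<dots> \<simeq> (if v = head E e then V v else 0) * H e"
    using assms by (intro lcong_right VV) auto
  also have "\<dots> \<simeq> (if v = head E e then H e else 0)"
    using * by auto
  finally show ?thesis .
qed

lemma HV:
  assumes "v \<in> verts E" "e \<in> arcs E"
  shows "H e * V v \<simeq> (if v = tail E e then H e else 0)"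
proof -
  have *: "H e * V (tail E e) \<simeq> H e"
    using assms by (intro relator_lcong lpa_relators.intros)
  have "H e * V v \<simeq> (H e * V (tail E e)) * V v"
    using assms by (intro lcong_right lcong_sym[OF *]) simp
  also have "\<dots> = H e * (V (tail E e) * V v)" by (simp add: mult.assoc)
  also have "\<dots> \<simeq> H e * (if tail E e = v then V (tail E e) else 0)"
    using assms by (intro lcong_left VV) auto
  also have "\<dots> \<simeq> (if v = tail E e then H e else 0)"
    using * by auto
  finally show ?thesis .
qed

lemma HD: "e \<in> arcs E \<Longrightarrow> f \<in> arcs E \<Longrightarrow> H e * D f \<simeq> (if e = f then V (head E e) else 0)"
  by (intro relator_lcong lpa_relators.intros)

section \<open>Real paths and ghost paths\<close>

definition pth :: "'e list \<Rightarrow> ('v, 'e) lpa_gen free_monoid \<Rightarrow>\<^sub>0 'k::field" where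
  "pth \<mu> = Poly_Mapping.single (Word (map Edge \<mu>)) 1"

text \<open>The star reverses a path, hence \<open>rev\<close>. The last letter is therefore the
  ghost of the first edge of \<nu>, and right multiplication acts on that edge.\<close>

definition gst :: "'e list \<Rightarrow> ('v, 'e) lpa_gen free_monoid \<Rightarrow>\<^sub>0 'k::field" where
  "gst \<nu> = Poly_Mapping.single (Word (map Ghost (rev \<nu>))) 1"

lemma pth_Nil [simp]: "pth [] = 1" and gst_Nil [simp]: "gst [] = 1"
  by (simp_all add: pth_def gst_def zero_free_monoid_def[symmetric])

lemma pth_snoc: "pth (\<mu> @ [e]) = pth \<mu> * D e"
  and gst_Cons: "gst (e # \<nu>) = gst \<nu> * H e"
  by (simp_all add: pth_def gst_def gen_def mult_single plus_free_monoid_def)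

text \<open>The range v of the path is passed along, since an empty list does not know its
  vertex.\<close>

definition src :: "'e list \<Rightarrow> 'v \<Rightarrow> 'v" where
  "src \<mu> v = (case \<mu> of [] \<Rightarrow> v | e # _ \<Rightarrow> tail E e)"

lemma src_simps [simp]: "src [] v = v" "src (e # \<mu>) v = tail E e"
  by (simp_all add: src_def)

fun path_to :: "'e list \<Rightarrow> 'v \<Rightarrow> bool" where
  "path_to [] v \<longleftrightarrow> True"
| "path_to (e # \<mu>) v \<longleftrightarrow> e \<in> arcs E \<and> head E e = src \<mu> v \<and> path_to \<mu> v"

lemma path_to_arcs: "path_to \<mu> v \<Longrightarrow> set \<mu> \<subseteq> arcs E"
  by (induction \<mu>) auto

lemma path_to_snoc: "path_to \<mu> (tail E e) \<Longrightarrow> e \<in> arcs E \<Longrightarrow> path_to (\<mu> @ [e]) (head E e)"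
proof (induction \<mu>)
  case (Cons f \<mu>)
  then show ?case by (cases \<mu>) auto
qed simp

lemma src_in_verts: "path_to \<mu> v \<Longrightarrow> v \<in> verts E \<Longrightarrow> src \<mu> v \<in> verts E"
  by (cases \<mu>) auto

lemma pth_free1: "path_to \<mu> v \<Longrightarrow> pth \<mu> \<in> free1"
  and gst_free1: "path_to \<mu> v \<Longrightarrow> gst \<mu> \<in> free1"
  using path_to_arcs[of \<mu> v]
  by (auto 4 3 simp: pth_def gst_def lpa_gens_def intro!: free_unital_algebra_single)

lemmas free1_intros = free_unital_algebra_intros pth_free1 gst_free1 V_free1 D_free1 H_free1

lemma V_gst_V:
  assumes "path_to \<nu> v" "v \<in> verts E" "u \<in> verts E"
  shows "V v * gst \<nu> * V u \<simeq> (if u = src \<nu> v then V v * gst \<nu> else 0)"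
proof (cases \<nu>)
  case Nil
  then show ?thesis using VV[of v u] assms by (auto split: if_splits)
next
  case (Cons e \<nu>')
  have "V v * gst \<nu> * V u = (V v * gst \<nu>') * (H e * V u)"
    by (simp add: Cons gst_Cons mult.assoc)
  also have "\<dots> \<simeq> (V v * gst \<nu>') * (if u = tail E e then H e else 0)"
    using assms by (intro lcong_left HV free_unital_algebra_mult gst_free1[of _ v]) (auto simp: Cons)
  also have "\<dots> = (if u = src \<nu> v then V v * gst \<nu> else 0)"
    by (simp add: Cons gst_Cons mult.assoc)
  finally show ?thesis .
qed

text \<open>The edge e meets the ghost of the first edge of \<nu>, so it either cancels it or gives
  zero. With an empty ghost part e survives, and it is written with its range vertex so that it can
  be appended to a real path on the left of v.\<close>

lemma V_gst_D:
  assumes "path_to \<nu> v" "v \<in> verts E" "e \<in> arcs E"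
  shows "V v * gst \<nu> * D e \<simeq> (case \<nu> of [] \<Rightarrow> if v = tail E e then D e * V (head E e) else 0
    | f # \<nu>' \<Rightarrow> if f = e then V v * gst \<nu>' else 0)"
proof (cases \<nu>)
  case Nil
  have "V v * D e \<simeq> (if v = tail E e then D e else 0)"
    using assms by (intro VD)
  also have "\<dots> \<simeq> (if v = tail E e then D e * V (head E e) else 0)"
    using lcong_sym[OF DV[of "head E e" e]] assms by auto
  finally show ?thesis by (simp add: Nil)
next
  case (Cons f \<nu>')
  have free: "V v * gst \<nu>' \<in> free1"
    using assms by (intro free_unital_algebra_mult gst_free1[of _ v]) (auto simp: Cons)
  have "V v * gst \<nu> * D e = (V v * gst \<nu>') * (H f * D e)"
    by (simp add: Cons gst_Cons mult.assoc)
  also have "\<dots> \<simeq> (V v * gst \<nu>') * (if f = e then V (head E f) else 0)"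
    using assms free by (intro lcong_left HD) (auto simp: Cons)
  also have "\<dots> = (if f = e then V v * gst \<nu>' * V (head E f) else 0)"
    by simp
  also have "\<dots> \<simeq> (if f = e then V v * gst \<nu>' else 0)"
    using V_gst_V[of \<nu>' v "head E f"] assms src_in_verts[of \<nu>' v] by (auto simp: Cons)
  finally show ?thesis by (simp add: Cons)
qed

lemma V_gst_H:
  assumes "path_to \<nu> v" "v \<in> verts E" "e \<in> arcs E"
  shows "V v * gst \<nu> * H e \<simeq> (if head E e = src \<nu> v then V v * gst (e # \<nu>) else 0)"
proof -
  have free: "V v * gst \<nu> \<in> free1"
    using assms by (intro free_unital_algebra_mult gst_free1[of _ v]) auto
  have "H e \<simeq> V (head E e) * H e"
    using lcong_sym[OF VH[of "head E e" e]] assms by simp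
  then have "V v * gst \<nu> * H e \<simeq> V v * gst \<nu> * (V (head E e) * H e)"
    using free by (rule lcong_left)
  also have "\<dots> = V v * gst \<nu> * V (head E e) * H e" by (simp add: mult.assoc)
  also have "\<dots> \<simeq> (if head E e = src \<nu> v then V v * gst \<nu> else 0) * H e"
    using assms by (intro lcong_right V_gst_V) auto
  also have "\<dots> = (if head E e = src \<nu> v then V v * gst (e # \<nu>) else 0)"
    by (simp add: gst_Cons mult.assoc)
  finally show ?thesis .
qed

text \<open>The rule \<open>step\<close> adds one scaled element of B at a time, so that inductions
  over a linear combination meet a single monomial in each step.\<close>

inductive_set cspan :: "(('v, 'e) lpa_gen free_monoid \<Rightarrow>\<^sub>0 'k::field) set \<Rightarrow>
    (('v, 'e) lpa_gen free_monoid \<Rightarrow>\<^sub>0 'k) set"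
  for B :: "(('v, 'e) lpa_gen free_monoid \<Rightarrow>\<^sub>0 'k) set" where
  rels: "f \<in> rels \<Longrightarrow> f \<in> cspan B"
| step: "b \<in> B \<Longrightarrow> f \<in> cspan B \<Longrightarrow> scale c b + f \<in> cspan B"

lemma cspan_zero: "0 \<in> cspan B"
  by (intro cspan.rels ideal_generated.zero)

lemma cspan_base: "b \<in> B \<Longrightarrow> b \<in> cspan B"
  using cspan.step[of b B 0 1] by (simp add: scale_simps cspan_zero)

lemma cspan_add: "f \<in> cspan B \<Longrightarrow> g \<in> cspan B \<Longrightarrow> f + g \<in> cspan B"
proof (induction rule: cspan.induct)
  case (rels f)
  from rels(2,1) show ?case
  proof (induction rule: cspan.induct)
    case (rels g)
    then show ?case by (auto intro: cspan.rels ideal_generated.add)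
  next
    case (step b g c)
    then show ?case using cspan.step[of b B "f + g" c] by (simp add: algebra_simps)
  qed
next
  case (step b f c)
  then show ?case using cspan.step[of b B "f + g" c] by (simp add: algebra_simps)
qed

lemma cspan_scale: "f \<in> cspan B \<Longrightarrow> scale c f \<in> cspan B"
proof (induction rule: cspan.induct)
  case (step b f d)
  then show ?case using cspan.step[of b B "scale c f" "c * d"] by (simp add: scale_simps)
qed (auto intro: cspan.rels ideal_generated.scale)

lemma cspan_lcong: "f \<simeq> g \<Longrightarrow> g \<in> cspan B \<Longrightarrow> f \<in> cspan B"
  using cspan_add[of "f - g" B g] cspan.rels[of "f - g" B] by (simp add: lcong_def)

lemma cspan_mono: "f \<in> cspan B \<Longrightarrow> B \<subseteq> C \<Longrightarrow> f \<in> cspan C"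
  by (induction rule: cspan.induct) (auto intro: cspan.intros)

lemma cspan_free1: "f \<in> cspan B \<Longrightarrow> B \<subseteq> free1 \<Longrightarrow> f \<in> free1"
  by (induction rule: cspan.induct) (use rels_free1 in \<open>auto intro!: free_unital_algebra_intros(4-)\<close>)

lemma cspan_mult_right:
  assumes "f \<in> cspan B" "a \<in> free1" "\<And>b. b \<in> B \<Longrightarrow> b * a \<in> cspan C"
  shows "f * a \<in> cspan C"
  using assms(1)
proof (induction rule: cspan.induct)
  case (step b f c)
  then show ?case
    using assms(3) by (auto simp: distrib_right scale_simps intro: cspan_add cspan_scale)
qed (use assms in \<open>auto intro: cspan.rels ideal_generated_mult_right\<close>)

section \<open>Spanning by monomials\<close>

definition mon :: "'e list \<Rightarrow> 'v \<Rightarrow> 'e list \<Rightarrow> ('v, 'e) lpa_gen free_monoid \<Rightarrow>\<^sub>0 'k::field" where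
  "mon \<mu> v \<nu> = pth \<mu> * (V v * gst \<nu>)"

text \<open>Only the ghost part is bounded: its length drops under right multiplication by an edge
  and is the induction measure in \<open>cspan_mons_faithful\<close>.\<close>

definition mons :: "nat \<Rightarrow> (('v, 'e) lpa_gen free_monoid \<Rightarrow>\<^sub>0 'k::field) set" where
  "mons N = {mon \<mu> v \<nu> | \<mu> v \<nu>. v \<in> verts E \<and> path_to \<mu> v \<and> path_to \<nu> v \<and> length \<nu> \<le> N}"

lemma mons_I: "v \<in> verts E \<Longrightarrow> path_to \<mu> v \<Longrightarrow> path_to \<nu> v \<Longrightarrow> length \<nu> \<le> N \<Longrightarrow> mon \<mu> v \<nu> \<in> mons N"
  by (auto simp: mons_def)

lemma mons_mono: "N \<le> M \<Longrightarrow> mons N \<subseteq> mons M"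
  by (force simp: mons_def)

lemma mons_free1: "mons N \<subseteq> free1"
  by (auto simp: mons_def mon_def intro: free1_intros)

lemma mon_V:
  assumes "v \<in> verts E" "path_to \<mu> v" "path_to \<nu> v" "u \<in> verts E"
  shows "mon \<mu> v \<nu> * V u \<simeq> (if u = src \<nu> v then mon \<mu> v \<nu> else 0)"
proof -
  have "pth \<mu> * (V v * gst \<nu> * V u) \<simeq> pth \<mu> * (if u = src \<nu> v then V v * gst \<nu> else 0)"
    using assms by (intro lcong_left V_gst_V pth_free1[of \<mu> v])
  then show ?thesis by (simp add: mon_def mult.assoc split: if_splits)
qed

text \<open>Truncated subtraction is right at N = 0: there e is appended to \<mu> and the ghost part
  stays empty.\<close>

lemma mons_mult_D:
  assumes "b \<in> mons N" "e \<in> arcs E"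
  shows "b * D e \<in> cspan (mons (N - 1))"
proof -
  obtain \<mu> v \<nu> where b: "b = mon \<mu> v \<nu>" "v \<in> verts E" "path_to \<mu> v" "path_to \<nu> v" "length \<nu> \<le> N"
    using assms by (auto simp: mons_def)
  let ?r = "case \<nu> of [] \<Rightarrow> if v = tail E e then D e * V (head E e) else 0
    | f # \<nu>' \<Rightarrow> if f = e then V v * gst \<nu>' else 0"
  have "b * D e = pth \<mu> * (V v * gst \<nu> * D e)"
    by (simp add: b mon_def mult.assoc)
  also have "\<dots> \<simeq> pth \<mu> * ?r"
    using assms b by (intro lcong_left V_gst_D pth_free1[of \<mu> v])
  finally have *: "b * D e \<simeq> pth \<mu> * ?r" .
  have "pth \<mu> * ?r \<in> cspan (mons (N - 1))"
  proof (cases \<nu>)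
    case Nil
    show ?thesis
    proof (cases "v = tail E e")
      case True
      have "pth \<mu> * ?r = mon (\<mu> @ [e]) (head E e) []"
        by (simp add: Nil True mon_def pth_snoc mult.assoc)
      also have "\<dots> \<in> mons (N - 1)"
        using b assms True by (intro mons_I path_to_snoc) auto
      finally show ?thesis by (rule cspan_base)
    qed (simp add: Nil cspan_zero)
  next
    case (Cons f \<nu>')
    then show ?thesis
      using b by (auto simp: cspan_zero mon_def[symmetric] intro!: cspan_base mons_I)
  qed
  with * show ?thesis by (rule cspan_lcong)
qed

lemma mons_mult_H:
  assumes "b \<in> mons N" "e \<in> arcs E"
  shows "b * H e \<in> cspan (mons (Suc N))"
proof -
  obtain \<mu> v \<nu> where b: "b = mon \<mu> v \<nu>" "v \<in> verts E" "path_to \<mu> v" "path_to \<nu> v" "length \<nu> \<le> N"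
    using assms by (auto simp: mons_def)
  let ?r = "if head E e = src \<nu> v then V v * gst (e # \<nu>) else 0"
  have "b * H e = pth \<mu> * (V v * gst \<nu> * H e)"
    by (simp add: b mon_def mult.assoc)
  also have "\<dots> \<simeq> pth \<mu> * ?r"
    using assms b by (intro lcong_left V_gst_H pth_free1[of \<mu> v])
  finally have *: "b * H e \<simeq> pth \<mu> * ?r" .
  have "pth \<mu> * ?r \<in> cspan (mons (Suc N))"
    using b assms by (auto simp: cspan_zero mon_def[symmetric] intro!: cspan_base mons_I)
  with * show ?thesis by (rule cspan_lcong)
qed

lemma mons_mult_V:
  assumes "b \<in> mons N" "u \<in> verts E"
  shows "b * V u \<in> cspan (mons N)"
proof -
  obtain \<mu> v \<nu> where b: "b = mon \<mu> v \<nu>" "v \<in> verts E" "path_to \<mu> v" "path_to \<nu> v" "length \<nu> \<le> N"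
    using assms by (auto simp: mons_def)
  have "(if u = src \<nu> v then b else 0) \<in> cspan (mons N)"
    using assms by (auto intro: cspan_base cspan_zero)
  then show ?thesis
    using mon_V[of v \<mu> \<nu> u] assms b by (auto intro: cspan_lcong)
qed

text \<open>Appending a letter to a monomial stays in the span of monomials and raises the ghost
  length by at most one. A single edge or ghost edge enters as its left vertex times itself.\<close>

lemma free_algebra_cspan:
  assumes "f \<in> free_algebra gens"
  shows "\<exists>N. f \<in> cspan (mons N)"
  using assms
proof (induction rule: free_algebra_induct)
  case zero
  then show ?case using cspan_zero by blast
next
  case (add f g)
  then obtain N M where "f \<in> cspan (mons N)" "g \<in> cspan (mons M)" by blast
  then have "f \<in> cspan (mons (max N M))" "g \<in> cspan (mons (max N M))"
    using mons_mono[of N "max N M"] mons_mono[of M "max N M"] by (auto elim: cspan_mono)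
  then show ?case using cspan_add by blast
next
  case (scale c f)
  then show ?case using cspan_scale by blast
next
  case (mult f x)
  then obtain N where N: "f \<in> cspan (mons N)" by blast
  from mult have "x \<in> Vertex ` verts E \<union> Edge ` arcs E \<union> Ghost ` arcs E" by (simp add: lpa_gens_def)
  then show ?case
  proof (elim UnE imageE)
    fix v assume x: "x = Vertex v" "v \<in> verts E"
    have "f * gen (Vertex v) \<in> cspan (mons N)"
      by (rule cspan_mult_right[OF N]) (use x in \<open>auto intro: mons_mult_V\<close>)
    then show ?case using x by blast
  next
    fix e assume x: "x = Edge e" "e \<in> arcs E"
    have "f * gen (Edge e) \<in> cspan (mons (N - 1))"
      by (rule cspan_mult_right[OF N]) (use x in \<open>simp_all add: mons_mult_D del: One_nat_def\<close>)
    then show ?case using x by blast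
  next
    fix e assume x: "x = Ghost e" "e \<in> arcs E"
    have "f * gen (Ghost e) \<in> cspan (mons (Suc N))"
      by (rule cspan_mult_right[OF N]) (use x in \<open>auto intro: mons_mult_H\<close>)
    then show ?case using x by blast
  qed
next
  case (gen x)
  then have "x \<in> Vertex ` verts E \<union> Edge ` arcs E \<union> Ghost ` arcs E" by (simp add: lpa_gens_def)
  moreover have V: "V v \<in> mons 0" if "v \<in> verts E" for v
    using mons_I[of v "[]" "[]" 0] that by (simp add: mon_def)
  ultimately show ?case
  proof (elim UnE imageE)
    fix v assume "x = Vertex v" "v \<in> verts E"
    then show ?case using cspan_base[OF V] by blast
  next
    fix e assume e: "x = Edge e" "e \<in> arcs E"
    have "D e \<simeq> V (tail E e) * D e"
      using lcong_sym[OF VD[of "tail E e" e]] e by simp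
    then show ?case
      using cspan_lcong mons_mult_D[OF V, of "tail E e" e] e by auto
  next
    fix e assume e: "x = Ghost e" "e \<in> arcs E"
    have "H e \<simeq> V (head E e) * H e"
      using lcong_sym[OF VH[of "head E e" e]] e by simp
    then show ?case
      using cspan_lcong mons_mult_H[OF V, of "head E e" e] e by auto
  qed
qed


section \<open>Sorting by the first ghost edge\<close>

definition arrows :: "'v \<Rightarrow> (('v, 'e) lpa_gen free_monoid \<Rightarrow>\<^sub>0 'k::field) set" where
  "arrows u = {pth \<mu> * V u | \<mu>. path_to \<mu> u}"

text \<open>Monomials whose ghost part does not start at u vanish under \<open>V u\<close>. The
  others are sorted by the first edge e of the ghost part, and those with empty ghost part make up
  p. The coefficients vanish off G so that the induction may insert one more edge into G.\<close>

lemma cspan_mons_decomposition: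
  assumes "a \<in> cspan (mons N)" "u \<in> verts E"
  shows "\<exists>p b G. p \<in> cspan (arrows u) \<and> finite G \<and> G \<subseteq> {e \<in> arcs E. tail E e = u} \<and>
    (N = 0 \<longrightarrow> G = {}) \<and> (\<forall>e. b e \<in> free1) \<and> (\<forall>e. e \<notin> G \<longrightarrow> b e = 0) \<and>
    a * V u \<simeq> p + (\<Sum>e\<in>G. b e * H e)"
  using assms(1)
proof (induction rule: cspan.induct)
  case (rels a)
  then have "a * V u \<simeq> 0"
    unfolding lcong_zero using assms by (intro ideal_generated_mult_right) auto
  then show ?case
    by (intro exI[of _ 0] exI[of _ "\<lambda>_. 0"] exI[of _ "{}"])
      (simp add: cspan_zero free_unital_algebra_zero)
next
  case (step m a c)
  then obtain p b G where a: "p \<in> cspan (arrows u)" "finite G" "G \<subseteq> {e \<in> arcs E. tail E e = u}"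
    "N = 0 \<longrightarrow> G = {}" "\<And>e. b e \<in> free1" "\<And>e. e \<notin> G \<Longrightarrow> b e = 0"
    "a * V u \<simeq> p + (\<Sum>e\<in>G. b e * H e)" by blast
  obtain \<mu> v \<nu> where m: "m = mon \<mu> v \<nu>" "v \<in> verts E" "path_to \<mu> v" "path_to \<nu> v" "length \<nu> \<le> N"
    using step by (auto simp: mons_def)
  let ?m = "if u = src \<nu> v then m else 0"
  have "m * V u \<simeq> ?m"
    unfolding m(1) using m assms by (intro mon_V)
  then have sum: "(scale c m + a) * V u \<simeq> scale c ?m + (p + (\<Sum>e\<in>G. b e * H e))"
    unfolding distrib_right scale_simps(7) by (intro lcong_add lcong_scale a)
  consider (zero) "u \<noteq> src \<nu> v" | (Nil) "\<nu> = []" "u = v"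
    | (Cons) e \<nu>' where "\<nu> = e # \<nu>'" "u = tail E e"
    by (cases \<nu>) auto
  then show ?case
  proof cases
    case zero
    then show ?thesis
      using a sum by (intro exI[of _ p] exI[of _ b] exI[of _ G]) (auto simp: scale_simps)
  next
    case Nil
    then have "m \<in> arrows u"
      using m by (auto simp: arrows_def mon_def)
    then have "scale c m + p \<in> cspan (arrows u)"
      using a(1) by (rule cspan.step)
    then show ?thesis
      using a sum Nil
      by (intro exI[of _ "scale c m + p"] exI[of _ b] exI[of _ G]) (auto simp: add.assoc)
  next
    case Cons
    \<comment> \<open>Removing the last letter \<open>H e\<close> from the new monomial leaves its
      contribution to the coefficient of e.\<close>
    let ?x = "scale c (mon \<mu> v \<nu>')"
    let ?b = "\<lambda>f. b f + (if f = e then ?x else 0)"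
    have x: "?x \<in> free1"
      using m by (auto simp: Cons mon_def intro!: free1_intros)
    have "(\<Sum>f\<in>insert e G. ?b f * H f) =
        (\<Sum>f\<in>insert e G. b f * H f) + (\<Sum>f\<in>insert e G. if f = e then ?x * H e else 0)"
      unfolding sum.distrib[symmetric] by (intro sum.cong) (auto simp: distrib_right)
    also have "(\<Sum>f\<in>insert e G. b f * H f) = (\<Sum>f\<in>G. b f * H f)"
      using a by (intro sum.mono_neutral_right) auto
    also have "(\<Sum>f\<in>insert e G. if f = e then ?x * H e else 0) = ?x * H e"
      using a by simp
    also have "?x * H e = scale c m"
      by (simp add: m(1) Cons mon_def gst_Cons mult.assoc scale_simps)
    finally have "(scale c m + a) * V u \<simeq> p + (\<Sum>f\<in>insert e G. ?b f * H f)"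
      using sum Cons by (simp add: algebra_simps)
    then show ?thesis
      using a m x Cons
      by (intro exI[of _ p] exI[of _ ?b] exI[of _ "insert e G"])
        (auto intro: free_unital_algebra_intros)
  qed
qed

section \<open>Point masses and independence of real paths\<close>

definition delta :: "'p \<Rightarrow> 'p \<Rightarrow> 'k::field" where
  "delta q p = (if p = q then 1 else 0)"

lemma lpa_op_Edge_delta:
  assumes "case_nat e x \<in> infinite_paths E"
  shows "lpa_op E (Edge e) (delta (x, n)) = delta (case_nat e x, n + 1)"
proof (rule ext, clarify)
  fix y m
  show "lpa_op E (Edge e) (delta (x, n)) (y, m) = delta (case_nat e x, n + 1) (y, m)"
    using assms by (auto simp: delta_def)
qed

lemma head_foldr_case_nat: "tail E ((foldr case_nat \<mu> x) 0) = src \<mu> (tail E (x 0))"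
  by (cases \<mu>) auto

lemma foldr_lpa_op_delta:
  assumes "x \<in> infinite_paths E" "path_to \<mu> (tail E (x 0))"
  shows "foldr case_nat \<mu> x \<in> infinite_paths E \<and>
    foldr (lpa_op E) (map Edge \<mu>) (delta (x, n)) =
      (delta (foldr case_nat \<mu> x, n + int (length \<mu>)) :: _ \<Rightarrow> 'k::field)"
  using assms
proof (induction \<mu>)
  case (Cons e \<mu>)
  then have IH: "foldr case_nat \<mu> x \<in> infinite_paths E"
    "foldr (lpa_op E) (map Edge \<mu>) (delta (x, n)) =
      (delta (foldr case_nat \<mu> x, n + int (length \<mu>)) :: _ \<Rightarrow> 'k)"
    by auto
  have "case_nat e (foldr case_nat \<mu> x) \<in> infinite_paths E"
    using Cons IH by (simp add: infinite_paths_case_nat head_foldr_case_nat)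
  with IH show ?case by (simp add: lpa_op_Edge_delta ac_simps)
qed simp

text \<open>Equal length matters: at a loop e, prepending e to eee... changes nothing. In the
  application the integer coordinate supplies the equality of lengths.\<close>

lemma foldr_case_nat_inject:
  "length \<mu> = length \<mu>' \<Longrightarrow> foldr case_nat \<mu> x = foldr case_nat \<mu>' x \<Longrightarrow> \<mu> = \<mu>'"
proof (induction \<mu> \<mu>' rule: list_induct2)
  case (Cons a \<mu> b \<mu>')
  then show ?case by (auto simp: case_nat_eq_iff)
qed simp

text \<open>Repeated paths are merged into one coefficient each, so that linear independence can be
  read off coefficient by coefficient.\<close>

lemma cspan_arrows_sum:
  assumes "p \<in> cspan (arrows u)"
  shows "\<exists>c M. finite M \<and> M \<subseteq> {\<mu>. path_to \<mu> u} \<and> (\<forall>\<mu>. \<mu> \<notin> M \<longrightarrow> c \<mu> = 0) \<and>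
    p \<simeq> (\<Sum>\<mu>\<in>M. scale (c \<mu>) (pth \<mu> * V u))"
  using assms
proof (induction rule: cspan.induct)
  case (rels f)
  then show ?case
    by (intro exI[of _ "\<lambda>_. 0"] exI[of _ "{}"]) (simp add: lcong_zero)
next
  case (step m p d)
  then obtain c M where p: "finite M" "M \<subseteq> {\<mu>. path_to \<mu> u}" "\<And>\<mu>. \<mu> \<notin> M \<Longrightarrow> c \<mu> = 0"
    "p \<simeq> (\<Sum>\<mu>\<in>M. scale (c \<mu>) (pth \<mu> * V u))" by blast
  obtain \<nu> where m: "m = pth \<nu> * V u" "path_to \<nu> u"
    using step by (auto simp: arrows_def)
  let ?c = "\<lambda>\<mu>. c \<mu> + (if \<mu> = \<nu> then d else 0)"
  have "(\<Sum>\<mu>\<in>insert \<nu> M. scale (?c \<mu>) (pth \<mu> * V u)) =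
      (\<Sum>\<mu>\<in>insert \<nu> M. scale (c \<mu>) (pth \<mu> * V u)) + (\<Sum>\<mu>\<in>insert \<nu> M. if \<mu> = \<nu> then scale d m else 0)"
    unfolding sum.distrib[symmetric]
    by (intro sum.cong) (auto simp: m scale_def single_add distrib_right)
  also have "(\<Sum>\<mu>\<in>insert \<nu> M. scale (c \<mu>) (pth \<mu> * V u)) = (\<Sum>\<mu>\<in>M. scale (c \<mu>) (pth \<mu> * V u))"
    using p by (intro sum.mono_neutral_right) (auto simp: scale_simps)
  also have "(\<Sum>\<mu>\<in>insert \<nu> M. if \<mu> = \<nu> then scale d m else 0) = scale d m"
    using p by simp
  finally have "scale d m + p \<simeq> (\<Sum>\<mu>\<in>insert \<nu> M. scale (?c \<mu>) (pth \<mu> * V u))"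
    using lcong_add[OF lcong_refl[of "scale d m"] p(4)] by (simp add: algebra_simps)
  then show ?case
    using p m by (intro exI[of _ ?c] exI[of _ "insert \<nu> M"]) auto
qed

text \<open>Apply p g to the point mass at (x, 0), where x starts at r(g): the path \<mu>
  contributes the point mass at (\<mu> g x, 1 + length of \<mu>). These points differ for different
  \<mu>, so all coefficients of p vanish. The factor g is there because in the application only p g,
  not p itself, is known to act as zero.\<close>

lemma arrows_faithful:
  fixes p :: "('v, 'e) lpa_gen free_monoid \<Rightarrow>\<^sub>0 'k::field"
  assumes p: "p \<in> cspan (arrows u)" and g: "g \<in> arcs E" "tail E g = u"
    and zero: "\<And>\<xi>. lpa_rep E (p * D g) \<xi> = (\<lambda>_. 0)"
  shows "p \<in> rels"
proof -
  obtain c M where M: "finite M" "M \<subseteq> {\<mu>. path_to \<mu> u}"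
    and sum: "p \<simeq> (\<Sum>\<mu>\<in>M. scale (c \<mu>) (pth \<mu> * V u))"
    using cspan_arrows_sum[OF p] by blast
  obtain x where x: "x \<in> infinite_paths E" "tail E (x 0) = head E g"
    using infinite_path_from[of "head E g"] g by auto
  let ?y = "case_nat g x"
  have y: "?y \<in> infinite_paths E"
    using x g by (simp add: infinite_paths_case_nat)
  have "lpa_op E (Vertex u) (delta (?y, 1)) = (delta (?y, 1) :: _ \<Rightarrow> 'k)"
    by (rule ext, clarify) (use y g in \<open>auto simp: delta_def\<close>)
  moreover have "lpa_op E (Edge g) (delta (x, 0)) = (delta (?y, 1) :: _ \<Rightarrow> 'k)"
    using lpa_op_Edge_delta[OF y, of 0] by simp
  moreover have "foldr (lpa_op E) (map Edge \<mu>) (delta (?y, 1)) =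
      (delta (foldr case_nat \<mu> ?y, 1 + int (length \<mu>)) :: _ \<Rightarrow> 'k)" if "\<mu> \<in> M" for \<mu>
    using foldr_lpa_op_delta[OF y, of \<mu> 1] that M g by auto
  ultimately have rep: "lpa_rep E (pth \<mu> * V u * D g) (delta (x, 0)) =
      (delta (foldr case_nat \<mu> ?y, 1 + int (length \<mu>)) :: _ \<Rightarrow> 'k)" if "\<mu> \<in> M" for \<mu>
    using that by (simp add: lpa_rep_mult pth_def rep_single)
  have c: "c \<mu> = 0" if "\<mu> \<in> M" for \<mu>
  proof -
    have "p * D g - (\<Sum>\<mu>\<in>M. scale (c \<mu>) (pth \<mu> * V u)) * D g \<in> rels"
      using lcong_right[OF sum, of "D g"] g by (simp add: lcong_def)
    from lpa_rep_ideal[OF this, of "delta (x, 0)"] zero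
    have "(\<Sum>\<nu>\<in>M. c \<nu> * lpa_rep E (pth \<nu> * V u * D g) (delta (x, 0)) q) = 0" for q
      by (cases q) (simp add: sum_distrib_right scale_simps fun_eq_iff)
    \<comment> \<open>Evaluation at the point belonging to \<mu> isolates its coefficient: the
      integer forces equal lengths, and then \<open>foldr_case_nat_inject\<close> applies.\<close>
    from this[of "(foldr case_nat \<mu> ?y, 1 + int (length \<mu>))"]
    have "(\<Sum>\<nu>\<in>M. c \<nu> * delta (foldr case_nat \<nu> ?y, 1 + int (length \<nu>))
        (foldr case_nat \<mu> ?y, 1 + int (length \<mu>))) = 0"
      by (simp add: rep)
    also have "(\<Sum>\<nu>\<in>M. c \<nu> * delta (foldr case_nat \<nu> ?y, 1 + int (length \<nu>))
        (foldr case_nat \<mu> ?y, 1 + int (length \<mu>))) = (\<Sum>\<nu>\<in>M. if \<nu> = \<mu> then c \<nu> else 0)"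
      by (intro sum.cong) (use foldr_case_nat_inject in \<open>fastforce simp: delta_def\<close>)+
    finally show ?thesis
      using M that by simp
  qed
  have "(\<Sum>\<mu>\<in>M. scale (c \<mu>) (pth \<mu> * V u)) = 0"
    by (simp add: c scale_simps)
  with sum show ?thesis by (simp add: lcong_zero)
qed

text \<open>At a finite emitter \<open>a = \<Sum>e. (a e) e\<^sup>*\<close> reduces to shorter ghost paths.  At an infinite
  emitter, multiplying by an edge \<open>g\<close> that begins no ghost path of \<open>a\<close> isolates the ghost-free
  part \<open>p\<close>.\<close>

lemma cspan_mons_faithful_vertex:
  assumes a: "a \<in> cspan (mons N)" and zero: "\<And>\<xi>. lpa_rep E a \<xi> = (\<lambda>_. 0)"
    and IH: "\<And>e. N \<noteq> 0 \<Longrightarrow> e \<in> arcs E \<Longrightarrow> a * D e \<in> rels"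
    and u: "u \<in> verts E"
  shows "a * V u \<in> rels"
proof -
  obtain p b G where p: "p \<in> cspan (arrows u)" and G: "finite G" "G \<subseteq> {e \<in> arcs E. tail E e = u}"
    "N = 0 \<Longrightarrow> G = {}" and b: "\<And>e. b e \<in> free1"
    and dec: "a * V u \<simeq> p + (\<Sum>e\<in>G. b e * H e)"
    using cspan_mons_decomposition[OF a u] by blast
  have a1: "a \<in> free1" by (rule cspan_free1[OF a mons_free1])
  have aD: "a * D e \<simeq> p * D e + (if e \<in> G then b e * V (head E e) else 0)"
    if e: "e \<in> arcs E" "tail E e = u" for e
  proof -
    have "D e \<simeq> V u * D e"
      using lcong_sym[OF VD[of u e]] e u by simp
    from lcong_left[OF this a1] have "a * D e \<simeq> (a * V u) * D e"
      by (simp add: mult.assoc)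
    also have "\<dots> \<simeq> (p + (\<Sum>f\<in>G. b f * H f)) * D e"
      using dec e by (intro lcong_right) auto
    also have "\<dots> = p * D e + (\<Sum>f\<in>G. b f * (H f * D e))"
      by (simp add: distrib_right sum_distrib_right mult.assoc)
    also have "\<dots> \<simeq> p * D e + (\<Sum>f\<in>G. b f * (if f = e then V (head E f) else 0))"
      using G b e by (intro lcong_add lcong_refl lcong_sum lcong_left HD) auto
    also have "(\<Sum>f\<in>G. b f * (if f = e then V (head E f) else 0)) =
        (\<Sum>f\<in>G. if f = e then b e * V (head E e) else 0)"
      by (intro sum.cong) auto
    also have "\<dots> = (if e \<in> G then b e * V (head E e) else 0)"
      using G by simp
    finally show ?thesis .
  qed
  show ?thesis
  proof (cases "{e \<in> arcs E. tail E e = u} \<subseteq> G")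
    case True
    let ?A = "{e \<in> arcs E. tail E e = u}"
    \<comment> \<open>Since u emits an edge, G is nonempty here; this excludes N = 0 and makes
      \<open>IH\<close> available.\<close>
    have "finite ?A" "?A \<noteq> {}" "N \<noteq> 0"
      using True G out_edge[OF u] by (auto intro: finite_subset)
    then have "V u \<simeq> (\<Sum>e\<in>?A. D e * H e)"
      using u by (intro relator_lcong lpa_relators.vertex_sum) (auto simp: fun_eq_iff)
    from lcong_left[OF this a1] have "a * V u \<simeq> (\<Sum>e\<in>?A. (a * D e) * H e)"
      by (simp add: sum_distrib_left mult.assoc)
    moreover have "(\<Sum>e\<in>?A. (a * D e) * H e) \<in> rels"
      using IH[OF \<open>N \<noteq> 0\<close>] by (intro ideal_generated_sum ideal_generated_mult_right[OF H_free1]) auto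
    ultimately show ?thesis by (rule lcong_in_rels)
  next
    case False
    then obtain g where g: "g \<in> arcs E" "tail E g = u" "g \<notin> G" by blast
    have "lpa_rep E (p * D g) \<xi> = (\<lambda>_. 0)" for \<xi>
    proof -
      have "a * D g - p * D g \<in> rels"
        using aD[of g] g by (simp add: lcong_def)
      from lpa_rep_ideal[OF this, of \<xi>] show ?thesis
        by (simp add: fun_eq_iff lpa_rep_mult zero)
    qed
    from arrows_faithful[OF p g(1,2) this] have p0: "p \<in> rels" .
    \<comment> \<open>With p gone, a e recovers the coefficient \<open>b e\<close> up to its range
      vertex, and \<open>IH\<close> kills a e.\<close>
    have "b e * H e \<in> rels" if e: "e \<in> G" for e
    proof -
      have e': "e \<in> arcs E" "tail E e = u" "N \<noteq> 0" using e G by auto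
      have "b e * V (head E e) \<simeq> b e * V (head E e) + p * D e"
        unfolding lcong_def using p0 e'
        by (simp add: ideal_generated_uminus ideal_generated_mult_right)
      also have "\<dots> \<simeq> a * D e"
        using lcong_sym[OF aD[of e]] e e' by (simp add: add.commute)
      finally have "b e * V (head E e) \<in> rels"
        by (rule lcong_in_rels) (rule IH[OF e'(3,1)])
      then have "b e * V (head E e) * H e \<in> rels"
        using e' by (intro ideal_generated_mult_right[OF H_free1]) auto
      moreover have "b e * H e \<simeq> b e * (V (head E e) * H e)"
        using lcong_sym[OF VH[of "head E e" e]] e' b by (intro lcong_left) auto
      ultimately show ?thesis
        by (simp add: mult.assoc lcong_in_rels)
    qed
    then have "p + (\<Sum>e\<in>G. b e * H e) \<in> rels"
      using p0 by (intro ideal_generated.add ideal_generated_sum)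
    with dec show ?thesis by (rule lcong_in_rels)
  qed
qed

text \<open>Finite sums of vertices replace the missing unit: each monomial needs just the source of
  its ghost part. The claim for every larger W lets the induction enlarge U without spoiling earlier
  summands.\<close>

lemma cspan_mons_local_unit:
  assumes "a \<in> cspan (mons N)"
  shows "\<exists>U. finite U \<and> U \<subseteq> verts E \<and>
    (\<forall>W. finite W \<longrightarrow> U \<subseteq> W \<longrightarrow> W \<subseteq> verts E \<longrightarrow> a \<simeq> (\<Sum>u\<in>W. a * V u))"
  using assms
proof (induction rule: cspan.induct)
  case (rels f)
  have "f \<simeq> (\<Sum>u\<in>W. f * V u)" if "W \<subseteq> verts E" for W
    unfolding lcong_def using rels that
    by (intro ideal_generated_diff ideal_generated_sum ideal_generated_mult_right) auto
  then show ?case by blast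
next
  case (step m f c)
  then obtain U where U: "finite U" "U \<subseteq> verts E"
    "\<And>W. finite W \<Longrightarrow> U \<subseteq> W \<Longrightarrow> W \<subseteq> verts E \<Longrightarrow> f \<simeq> (\<Sum>u\<in>W. f * V u)" by blast
  obtain \<mu> v \<nu> where m: "m = mon \<mu> v \<nu>" "v \<in> verts E" "path_to \<mu> v" "path_to \<nu> v"
    using step by (auto simp: mons_def)
  have "scale c m + f \<simeq> (\<Sum>u\<in>W. (scale c m + f) * V u)"
    if W: "finite W" "insert (src \<nu> v) U \<subseteq> W" "W \<subseteq> verts E" for W
  proof -
    have "(\<Sum>u\<in>W. m * V u) \<simeq> (\<Sum>u\<in>W. if u = src \<nu> v then m else 0)"
      unfolding m(1) using m W by (intro lcong_sum mon_V) auto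
    also have "\<dots> = m" using W by simp
    finally have "m \<simeq> (\<Sum>u\<in>W. m * V u)" by (rule lcong_sym)
    then have "scale c m + f \<simeq> scale c (\<Sum>u\<in>W. m * V u) + (\<Sum>u\<in>W. f * V u)"
      using W by (intro lcong_add lcong_scale U) auto
    then show ?thesis
      by (simp add: scale_sum sum.distrib distrib_right scale_simps)
  qed
  then show ?case
    using U m src_in_verts[of \<nu> v] by (intro exI[of _ "insert (src \<nu> v) U"]) auto
qed

text \<open>Right multiplication by an edge keeps the operator zero and lowers N, so the induction
  hypothesis covers all a e. From these one gets every a u, and a is a finite sum of such
  products.\<close>

lemma cspan_mons_faithful:
  assumes "a \<in> cspan (mons N)" "\<And>\<xi>. lpa_rep E a \<xi> = (\<lambda>_. 0)"
  shows "a \<in> rels"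
  using assms
proof (induction N arbitrary: a rule: less_induct)
  case (less N a)
  have "a * D e \<in> rels" if "N \<noteq> 0" "e \<in> arcs E" for e
  proof (rule less.IH)
    show "N - 1 < N" using that by simp
    show "a * D e \<in> cspan (mons (N - 1))"
      using that by (intro cspan_mult_right[OF less.prems(1)] mons_mult_D) auto
    show "lpa_rep E (a * D e) \<xi> = (\<lambda>_. 0)" for \<xi>
      by (simp add: lpa_rep_mult less.prems(2))
  qed
  then have u: "a * V u \<in> rels" if "u \<in> verts E" for u
    using that cspan_mons_faithful_vertex[OF less.prems] by blast
  obtain U where "U \<subseteq> verts E" "a \<simeq> (\<Sum>u\<in>U. a * V u)"
    using cspan_mons_local_unit[OF less.prems(1)] by blast
  moreover from this u have "(\<Sum>u\<in>U. a * V u) \<in> rels"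
    by (intro ideal_generated_sum) auto
  ultimately show ?case by (blast intro: lcong_in_rels)
qed

text \<open>Evaluation at infinite paths suffices by \<open>lpa_rep_off_paths\<close>, and in this
  form the criterion can be carried along a bijection of path spaces.\<close>

theorem lpa_rep_faithful:
  assumes "f \<in> free_algebra gens"
  shows "f \<in> rels \<longleftrightarrow> (\<forall>\<xi>. \<forall>x\<in>infinite_paths E. \<forall>n. lpa_rep E f \<xi> (x, n) = 0)"
proof
  assume "f \<in> rels"
  then show "\<forall>\<xi>. \<forall>x\<in>infinite_paths E. \<forall>n. lpa_rep E f \<xi> (x, n) = 0"
    by (simp add: lpa_rep_ideal)
next
  assume "\<forall>\<xi>. \<forall>x\<in>infinite_paths E. \<forall>n. lpa_rep E f \<xi> (x, n) = 0"
  with lpa_rep_off_paths[OF assms] have "lpa_rep E f \<xi> (x, n) = 0" for \<xi> x n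
    by blast
  then have "lpa_rep E f \<xi> = (\<lambda>_. 0)" for \<xi>
    by (auto simp: fun_eq_iff)
  moreover obtain N where "f \<in> cspan (mons N)"
    using free_algebra_cspan[OF assms] by blast
  ultimately show "f \<in> rels" by (blast intro: cspan_mons_faithful)
qed

end

section \<open>The topology of edge shifts\<close>

text \<open>Compactness is used twice. For p in C, finitely many members of \<B> that miss p cover
  the complement of C, so the complement of their union is a member of \<B> that contains p and lies
  in C. Finitely many of these then cover C.\<close>

lemma clopen_in_separating_algebra:
  assumes X: "compact_space X"
    and openin: "\<And>S. S \<in> \<B> \<Longrightarrow> openin X S"
    and whole: "topspace X \<in> \<B>"
    and compl: "\<And>S. S \<in> \<B> \<Longrightarrow> topspace X - S \<in> \<B>"
    and inter: "\<And>S T. S \<in> \<B> \<Longrightarrow> T \<in> \<B> \<Longrightarrow> S \<inter> T \<in> \<B>"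
    and sep: "\<And>x y. x \<in> topspace X \<Longrightarrow> y \<in> topspace X \<Longrightarrow> x \<noteq> y \<Longrightarrow> \<exists>S\<in>\<B>. x \<in> S \<longleftrightarrow> y \<notin> S"
    and C: "openin X C" "closedin X C"
  shows "C \<in> \<B>"
proof -
  have sub: "S \<subseteq> topspace X" if "S \<in> \<B>" for S
    using openin[OF that] by (rule openin_subset)
  have empty: "{} \<in> \<B>" using compl[OF whole] by simp
  have un: "S \<union> T \<in> \<B>" if "S \<in> \<B>" "T \<in> \<B>" for S T
  proof -
    have "topspace X - ((topspace X - S) \<inter> (topspace X - T)) \<in> \<B>"
      using that by (intro compl inter)
    moreover have "topspace X - ((topspace X - S) \<inter> (topspace X - T)) = S \<union> T"
      using sub that by blast
    ultimately show ?thesis by simp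
  qed
  have Un: "\<Union>\<F> \<in> \<B>" if "finite \<F>" "\<F> \<subseteq> \<B>" for \<F>
    using that by (induction rule: finite_induct) (auto intro: empty un)
  have nhd: "\<exists>S\<in>\<B>. p \<in> S \<and> S \<subseteq> C" if p: "p \<in> C" for p
  proof -
    have pX: "p \<in> topspace X" using p C openin_subset by blast
    have "compactin X (topspace X - C)"
      using X C by (intro closedin_compact_space) auto
    moreover have "topspace X - C \<subseteq> \<Union>{T \<in> \<B>. p \<notin> T}"
    proof
      fix y assume y: "y \<in> topspace X - C"
      then obtain S where "S \<in> \<B>" "p \<in> S \<longleftrightarrow> y \<notin> S"
        using sep[OF pX, of y] p by blast
      then show "y \<in> \<Union>{T \<in> \<B>. p \<notin> T}"
        using compl[of S] y pX by (cases "p \<in> S") auto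
    qed
    ultimately obtain \<F> where F: "finite \<F>" "\<F> \<subseteq> {T \<in> \<B>. p \<notin> T}" "topspace X - C \<subseteq> \<Union>\<F>"
      using compactinD[of X "topspace X - C" "{T \<in> \<B>. p \<notin> T}"] openin by blast
    then have "topspace X - \<Union>\<F> \<in> \<B>"
      by (intro compl Un) auto
    then show ?thesis
      using F pX by (intro bexI[of _ "topspace X - \<Union>\<F>"]) auto
  qed
  have "compactin X C"
    using X C by (intro closedin_compact_space)
  moreover have "C \<subseteq> \<Union>{S \<in> \<B>. S \<subseteq> C}"
    using nhd by blast
  ultimately obtain \<F> where F: "finite \<F>" "\<F> \<subseteq> {S \<in> \<B>. S \<subseteq> C}" "C \<subseteq> \<Union>\<F>"
    using compactinD[of X C "{S \<in> \<B>. S \<subseteq> C}"] openin by blast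
  then have "C = \<Union>\<F>" "\<F> \<subseteq> \<B>" by auto
  then show ?thesis using Un F by simp
qed

lemma compact_space_quotient_topology:
  assumes "compact_space X"
  shows "compact_space (quotient_topology X f)"
proof -
  have "compactin (quotient_topology X f) (f ` topspace X)"
    using assms
    by (intro image_compactin[of X] quotient_imp_continuous_map quotient_map_quotient_topology)
      (simp add: compact_space_def)
  then show ?thesis
    by (simp add: compact_space_def topspace_quotient_topology)
qed

section \<open>Cylinder sets\<close>

fun starts_with :: "'a list \<Rightarrow> 'a sequence \<Rightarrow> bool" where
  "starts_with w (Fin v) \<longleftrightarrow> take (length w) v = w"
| "starts_with w (Inf x) \<longleftrightarrow> (\<forall>i<length w. x i = w ! i)"

lemma starts_with_Nil [simp]: "starts_with [] x"
  by (cases x) auto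

lemma starts_with_Cons_Inf:
  "starts_with (a # w) (Inf x) \<longleftrightarrow> x 0 = a \<and> starts_with w (Inf (\<lambda>i. x (Suc i)))"
  by (auto simp: All_less_Suc2)

text \<open>A cylinder pulls back to a condition on finitely many coordinates: requiring
  \<open>Some\<close> there already forces the truncation point beyond w.\<close>

lemma starts_with_truncate_seq:
  "starts_with w (truncate_seq x) \<longleftrightarrow> (\<forall>i<length w. x i = Some (w ! i))"
proof (cases "\<exists>n. x n = None")
  case True
  define L where "L = (LEAST n. x n = None)"
  have L: "x L = None"
    unfolding L_def using True by (rule LeastI_ex)
  have less: "\<exists>a. x i = Some a" if "i < L" for i
    using not_less_Least[of i "\<lambda>n. x n = None"] that by (auto simp: L_def)
  have "starts_with w (truncate_seq x) \<longleftrightarrow> take (length w) (map (\<lambda>i. the (x i)) [0..<L]) = w"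
    using True by (simp add: truncate_seq_def L_def)
  also have "\<dots> \<longleftrightarrow> length w \<le> L \<and> (\<forall>i<length w. the (x i) = w ! i)"
    by (auto simp: list_eq_iff_nth_eq)
  also have "\<dots> \<longleftrightarrow> (\<forall>i<length w. x i = Some (w ! i))"
  proof
    assume "length w \<le> L \<and> (\<forall>i<length w. the (x i) = w ! i)"
    with less show "\<forall>i<length w. x i = Some (w ! i)"
      by (metis option.sel order_less_le_trans)
  next
    assume R: "\<forall>i<length w. x i = Some (w ! i)"
    then have "\<not> L < length w" using L by auto
    with R show "length w \<le> L \<and> (\<forall>i<length w. the (x i) = w ! i)" by simp
  qed
  finally show ?thesis .
next
  case False
  then have "x i = Some a \<longleftrightarrow> the (x i) = a" for i a
    by (cases "x i") (auto dest: spec[of _ i])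
  moreover have "truncate_seq x = Inf (\<lambda>i. the (x i))"
    using False by (simp add: truncate_seq_def)
  ultimately show ?thesis by simp
qed

lemma starts_with_separates:
  assumes "x \<in> full_shift A" "y \<in> full_shift A" "x \<noteq> y"
  shows "\<exists>w. set w \<subseteq> A \<and> (starts_with w x \<longleftrightarrow> \<not> starts_with w y)"
proof (rule ccontr)
  assume "\<not> ?thesis"
  then have *: "starts_with w x \<longleftrightarrow> starts_with w y" if "set w \<subseteq> A" for w
    using that by blast
  have FinD: "set v \<subseteq> A" if "Fin v \<in> full_shift A" for v
    using that by (auto simp: full_shift_def split: if_splits)
  have InfD: "range u \<subseteq> A" if "Inf u \<in> full_shift A" for u
    using that by (auto simp: full_shift_def split: if_splits)
  have Inf_prefix: "set (map u [0..<k]) \<subseteq> A" if "Inf u \<in> full_shift A" for u k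
    using InfD[OF that] by auto
  show False
  proof (cases x; cases y)
    fix v v' assume xy: "x = Fin v" "y = Fin v'"
    then have "take (length v) v' = v" "take (length v') v = v'"
      using *[of v] *[of v'] FinD[of v] FinD[of v'] assms by auto
    then have "v = v'"
      by (metis length_take min.cobounded1 nle_le take_all_iff)
    then show False using xy assms by simp
  next
    fix v u assume xy: "x = Fin v" "y = Inf u"
    \<comment> \<open>A prefix of u that is one letter longer than v cannot begin the sequence
      \<open>Fin v\<close>.\<close>
    have "starts_with (map u [0..<Suc (length v)]) y" "\<not> starts_with (map u [0..<Suc (length v)]) x"
      unfolding xy by (auto simp del: upt_Suc dest!: arg_cong[where f = length])
    then show False using * Inf_prefix[of u] xy assms by metis
  next
    fix v u assume xy: "x = Inf u" "y = Fin v"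
    have "starts_with (map u [0..<Suc (length v)]) x" "\<not> starts_with (map u [0..<Suc (length v)]) y"
      unfolding xy by (auto simp del: upt_Suc dest!: arg_cong[where f = length])
    then show False using * Inf_prefix[of u] xy assms by metis
  next
    fix u u' assume xy: "x = Inf u" "y = Inf u'"
    then have "u' i = u i" for i
      using *[of "map u [0..<Suc i]"] Inf_prefix[of u "Suc i"] assms by (auto simp del: upt_Suc)
    then show False using xy assms by auto
  qed
qed

lemma clopen_finite_conj:
  fixes n :: nat
  assumes "\<And>i. i < n \<Longrightarrow> openin X {x \<in> topspace X. P i x} \<and> closedin X {x \<in> topspace X. P i x}"
  shows "openin X {x \<in> topspace X. \<forall>i<n. P i x} \<and> closedin X {x \<in> topspace X. \<forall>i<n. P i x}"
  using assms
proof (induction n)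
  case (Suc n)
  have "{x \<in> topspace X. \<forall>i<Suc n. P i x} =
      {x \<in> topspace X. \<forall>i<n. P i x} \<inter> {x \<in> topspace X. P n x}"
    by (auto simp: less_Suc_eq)
  with Suc show ?case by (auto intro: openin_Int closedin_Int)
qed simp

lemma clopen_product_cylinder:
  fixes n :: nat
  assumes "\<And>i. i < n \<Longrightarrow> openin X {a i} \<and> closedin X {a i}"
  shows "openin (product_topology (\<lambda>_. X) UNIV) {x \<in> topspace (product_topology (\<lambda>_. X) UNIV). \<forall>i<n. x i = a i} \<and>
    closedin (product_topology (\<lambda>_. X) UNIV) {x \<in> topspace (product_topology (\<lambda>_. X) UNIV). \<forall>i<n. x i = a i}"
proof (rule clopen_finite_conj[where P = "\<lambda>i x. x i = a i"])
  fix i :: nat assume "i < n"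
  have "continuous_map (product_topology (\<lambda>_. X) UNIV) X (\<lambda>x. x i)"
    by (rule continuous_map_product_projection) simp
  from openin_continuous_map_preimage[OF this, of "{a i}"] closedin_continuous_map_preimage[OF this, of "{a i}"]
  show "openin (product_topology (\<lambda>_. X) UNIV) {x \<in> topspace (product_topology (\<lambda>_. X) UNIV). x i = a i} \<and>
    closedin (product_topology (\<lambda>_. X) UNIV) {x \<in> topspace (product_topology (\<lambda>_. X) UNIV). x i = a i}"
    using assms[OF \<open>i < n\<close>] by simp
qed

lemma clopen_quotient_topology:
  assumes "openin X {x \<in> topspace X. f x \<in> U} \<and> closedin X {x \<in> topspace X. f x \<in> U}"
    and "U \<subseteq> f ` topspace X"
  shows "openin (quotient_topology X f) U \<and> closedin (quotient_topology X f) U"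
proof -
  have "{x \<in> topspace X. f x \<in> f ` topspace X - U} = topspace X - {x \<in> topspace X. f x \<in> U}"
    by auto
  then show ?thesis
    using assms by (auto simp: openin_quotient_topology closedin_def topspace_quotient_topology)
qed

text \<open>A single letter is clopen even in the compactified alphabet, being open and compact;
  only the added point is a limit of letters. Pulled back along the quotient map, the cylinder fixes
  finitely many letters.\<close>

lemma clopen_cylinder_full_shift:
  assumes w: "set w \<subseteq> A"
  shows "openin (full_shift_topology A) {x \<in> full_shift A. starts_with w x} \<and>
    closedin (full_shift_topology A) {x \<in> full_shift A. starts_with w x}"
proof (cases "finite A")
  case True
  let ?X = "product_topology (\<lambda>_::nat. discrete_topology A) UNIV"
  have top: "full_shift_topology A = quotient_topology ?X Inf"
    using True by (simp add: full_shift_topology_def)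
  have im: "full_shift A = Inf ` topspace ?X"
    using topspace_full_shift_topology[of A] by (simp only: top topspace_quotient_topology)
  have "{x \<in> topspace ?X. Inf x \<in> {x \<in> full_shift A. starts_with w x}} =
      {x \<in> topspace ?X. \<forall>i<length w. x i = w ! i}"
    unfolding im by auto
  moreover have "openin ?X {x \<in> topspace ?X. \<forall>i<length w. x i = w ! i} \<and>
      closedin ?X {x \<in> topspace ?X. \<forall>i<length w. x i = w ! i}"
    using w by (intro clopen_product_cylinder) (auto simp: subset_eq)
  ultimately show ?thesis
    unfolding top by (intro clopen_quotient_topology) (auto simp: im)
next
  case False
  let ?X = "product_topology (\<lambda>_::nat. Alexandroff_compactification (discrete_topology A)) UNIV"
  have top: "full_shift_topology A = quotient_topology ?X truncate_seq"
    using False by (simp add: full_shift_topology_def)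
  have im: "full_shift A = truncate_seq ` topspace ?X"
    using topspace_full_shift_topology[of A] by (simp only: top topspace_quotient_topology)
  have "{x \<in> topspace ?X. truncate_seq x \<in> {x \<in> full_shift A. starts_with w x}} =
      {x \<in> topspace ?X. \<forall>i<length w. x i = Some (w ! i)}"
    unfolding im by (auto simp: starts_with_truncate_seq)
  moreover have "openin ?X {x \<in> topspace ?X. \<forall>i<length w. x i = Some (w ! i)} \<and>
      closedin ?X {x \<in> topspace ?X. \<forall>i<length w. x i = Some (w ! i)}"
  proof (rule clopen_product_cylinder)
    fix i assume "i < length w"
    then have "w ! i \<in> A" using w by (auto simp: subset_eq)
    then show "openin (Alexandroff_compactification (discrete_topology A)) {Some (w ! i)} \<and>
        closedin (Alexandroff_compactification (discrete_topology A)) {Some (w ! i)}"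
      using openin_Alexandroff_compactification_image_Some[of "discrete_topology A" "{w ! i}"]
        closedin_Alexandroff_compactification_image_Some[of "discrete_topology A" "{w ! i}"]
      by (simp add: finite_imp_compactin)
  qed
  ultimately show ?thesis
    unfolding top by (intro clopen_quotient_topology) (auto simp: im)
qed

section \<open>Edge shifts as compact Hausdorff spaces\<close>

lemma compact_space_full_shift_topology: "compact_space (full_shift_topology A)"
  by (auto simp: full_shift_topology_def compact_space_product_topology compact_space_discrete_topology
      intro!: compact_space_quotient_topology)

lemma topspace_edge_shift_topology [simp]: "topspace (edge_shift_topology E) = edge_shift E"
  unfolding edge_shift_topology_def edge_shift_def
  by (simp add: closure_of_subset_topspace inf.absorb2)

lemma edge_shift_subset_full_shift: "edge_shift E \<subseteq> full_shift (arcs E)"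
  using closure_of_subset_topspace[of "full_shift_topology (arcs E)"]
  by (simp add: edge_shift_def topspace_full_shift_topology)

lemma compact_space_edge_shift_topology: "compact_space (edge_shift_topology E)"
  unfolding edge_shift_topology_def
  by (intro compact_space_subtopology closedin_compact_space compact_space_full_shift_topology)
    (simp add: edge_shift_def)

lemma clopen_cylinder_edge_shift:
  assumes "set w \<subseteq> arcs E"
  shows "openin (edge_shift_topology E) {x \<in> edge_shift E. starts_with w x}"
    and "closedin (edge_shift_topology E) {x \<in> edge_shift E. starts_with w x}"
proof -
  have "{x \<in> edge_shift E. starts_with w x} = edge_shift E \<inter> {x \<in> full_shift (arcs E). starts_with w x}"
    using edge_shift_subset_full_shift by blast
  then show "openin (edge_shift_topology E) {x \<in> edge_shift E. starts_with w x}"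
    and "closedin (edge_shift_topology E) {x \<in> edge_shift E. starts_with w x}"
    using clopen_cylinder_full_shift[OF assms]
    by (auto simp: edge_shift_topology_def openin_subtopology closedin_subtopology)
qed

text \<open>Distinct points are separated by a clopen cylinder. Together with compactness this makes
  a continuous bijection of edge shifts a homeomorphism, whence conjugacies have inverses.\<close>

lemma Hausdorff_space_edge_shift_topology: "Hausdorff_space (edge_shift_topology E)"
  unfolding Hausdorff_space_def
proof (intro allI impI)
  fix x y
  assume xy: "x \<in> topspace (edge_shift_topology E) \<and> y \<in> topspace (edge_shift_topology E) \<and> x \<noteq> y"
  then obtain w where w: "set w \<subseteq> arcs E" "starts_with w x \<longleftrightarrow> \<not> starts_with w y"
    using starts_with_separates[of x "arcs E" y] edge_shift_subset_full_shift[of E] by auto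
  let ?S = "{x \<in> edge_shift E. starts_with w x}"
  have S: "openin (edge_shift_topology E) ?S" "openin (edge_shift_topology E) (edge_shift E - ?S)"
    using clopen_cylinder_edge_shift[OF w(1)] by (auto simp: closedin_def)
  show "\<exists>U V. openin (edge_shift_topology E) U \<and> openin (edge_shift_topology E) V \<and>
      x \<in> U \<and> y \<in> V \<and> disjnt U V"
  proof (cases "starts_with w x")
    case True
    with S w xy show ?thesis
      by (intro exI[of _ ?S] exI[of _ "edge_shift E - ?S"]) (auto simp: disjnt_iff)
  next
    case False
    with S w xy show ?thesis
      by (intro exI[of _ ?S] exI[of _ "edge_shift E - ?S"] exI) (auto simp: disjnt_iff)
  qed
qed

text \<open>The closure adds at most finite sequences. Whether edges i and i + 1 compose is visible
  on the prefix of length i + 2, and the open cylinder of this prefix must contain a genuine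
  path.\<close>

lemma Inf_in_edge_shift_iff: "Inf x \<in> edge_shift E \<longleftrightarrow> x \<in> infinite_paths E"
proof
  assume x: "Inf x \<in> edge_shift E"
  then have "range x \<subseteq> arcs E"
    using edge_shift_subset_full_shift[of E] by (force simp: full_shift_def split: if_splits)
  have "x i \<in> arcs E \<and> head E (x i) = tail E (x (Suc i))" for i
  proof -
    let ?w = "map x [0..<Suc (Suc i)]"
    define S where "S = {y \<in> full_shift (arcs E). starts_with ?w y}"
    have "set ?w \<subseteq> arcs E" using \<open>range x \<subseteq> arcs E\<close> by auto
    then have "openin (full_shift_topology (arcs E)) S"
      unfolding S_def using clopen_cylinder_full_shift by blast
    moreover have "Inf x \<in> S"
      using x edge_shift_subset_full_shift[of E] by (auto simp: S_def simp del: upt_Suc)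
    moreover have "\<exists>z\<in>Inf ` infinite_paths E. z \<in> T"
      if "Inf x \<in> T" "openin (full_shift_topology (arcs E)) T" for T
      using x that unfolding edge_shift_def in_closure_of by blast
    ultimately obtain z where z: "z \<in> Inf ` infinite_paths E" "z \<in> S" by blast
    then obtain y where y: "y \<in> infinite_paths E" "starts_with ?w (Inf y)"
      unfolding S_def by blast
    then have "\<forall>j<Suc (Suc i). y j = ?w ! j" by simp
    moreover have "?w ! j = x j" if "j < Suc (Suc i)" for j
      using that by (simp del: upt_Suc)
    ultimately have "y i = x i" "y (Suc i) = x (Suc i)" by simp_all
    moreover have "y i \<in> arcs E \<and> head E (y i) = tail E (y (Suc i))"
      using y(1) by (simp add: infinite_paths_def)
    ultimately show ?thesis by simp
  qed
  then show "x \<in> infinite_paths E" by (simp add: infinite_paths_def)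
next
  have "Inf ` infinite_paths E \<subseteq> topspace (full_shift_topology (arcs E))"
    by (auto simp: topspace_full_shift_topology full_shift_def infinite_paths_def)
  from closure_of_subset[OF this]
  show "x \<in> infinite_paths E \<Longrightarrow> Inf x \<in> edge_shift E" by (auto simp: edge_shift_def)
qed

text \<open>Commutation is stated at infinite paths, whose shifts are again infinite paths. In this
  form it passes to the inverse without asking where the shift sends finite sequences.\<close>

definition is_conjugacy ::
    "('v, 'e) pre_digraph \<Rightarrow> ('w, 'f) pre_digraph \<Rightarrow> ('e sequence \<Rightarrow> 'f sequence) \<Rightarrow> bool" where
  "is_conjugacy E F \<phi> \<longleftrightarrow>
     continuous_map (edge_shift_topology E) (edge_shift_topology F) \<phi> \<and>
     bij_betw \<phi> (edge_shift E) (edge_shift F) \<and>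
     (\<forall>x\<in>infinite_paths E. \<phi> (shift_map (Inf x)) = shift_map (\<phi> (Inf x))) \<and>
     (\<forall>x\<in>edge_shift E. seq_length (\<phi> x) = seq_length x)"

lemma infinite_paths_conjugacy:
  assumes "is_conjugacy E F \<phi>" "x \<in> infinite_paths E"
  shows "\<exists>y\<in>infinite_paths F. \<phi> (Inf x) = Inf y"
proof -
  have x: "Inf x \<in> edge_shift E" using assms Inf_in_edge_shift_iff by blast
  then have "\<phi> (Inf x) \<in> edge_shift F" "seq_length (\<phi> (Inf x)) = \<infinity>"
    using assms by (auto simp: is_conjugacy_def bij_betw_def)
  then show ?thesis
    by (cases "\<phi> (Inf x)") (auto simp: Inf_in_edge_shift_iff)
qed

lemma is_conjugacy_inverse:
  assumes \<phi>: "is_conjugacy E F \<phi>"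
  obtains \<psi> where "is_conjugacy F E \<psi>" "\<And>x. x \<in> edge_shift E \<Longrightarrow> \<psi> (\<phi> x) = x"
    "\<And>y. y \<in> edge_shift F \<Longrightarrow> \<phi> (\<psi> y) = y"
proof -
  have "homeomorphic_map (edge_shift_topology E) (edge_shift_topology F) \<phi>"
    using \<phi> by (intro continuous_imp_homeomorphic_map compact_space_edge_shift_topology
        Hausdorff_space_edge_shift_topology) (auto simp: is_conjugacy_def bij_betw_def)
  then obtain \<psi> where \<psi>: "continuous_map (edge_shift_topology F) (edge_shift_topology E) \<psi>"
    and inv: "\<And>x. x \<in> edge_shift E \<Longrightarrow> \<psi> (\<phi> x) = x" "\<And>y. y \<in> edge_shift F \<Longrightarrow> \<phi> (\<psi> y) = y"
    by (auto simp: homeomorphic_map_maps homeomorphic_maps_def)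
  have maps: "\<phi> x \<in> edge_shift F" if "x \<in> edge_shift E" for x
    using \<phi> that by (auto simp: is_conjugacy_def bij_betw_def)
  have maps': "\<psi> y \<in> edge_shift E" if "y \<in> edge_shift F" for y
    using continuous_map_funspace[OF \<psi>] that by auto
  have "is_conjugacy F E \<psi>"
    unfolding is_conjugacy_def
  proof (intro conjI ballI)
    show "bij_betw \<psi> (edge_shift F) (edge_shift E)"
      by (rule bij_betw_byWitness[where f' = \<phi>]) (use inv maps maps' in auto)
    show len: "seq_length (\<psi> y) = seq_length y" if "y \<in> edge_shift F" for y
    proof -
      have "seq_length (\<phi> (\<psi> y)) = seq_length (\<psi> y)"
        using \<phi> maps'[OF that] unfolding is_conjugacy_def by blast
      then show ?thesis by (simp add: inv that)
    qed
    fix y assume y: "y \<in> infinite_paths F"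
    then have yF: "Inf y \<in> edge_shift F" by (simp add: Inf_in_edge_shift_iff)
    then obtain x where x: "\<psi> (Inf y) = Inf x"
      using len[of "Inf y"] by (cases "\<psi> (Inf y)") auto
    with maps'[OF yF] have xE: "x \<in> infinite_paths E" by (simp add: Inf_in_edge_shift_iff)
    then have "\<phi> (shift_map (Inf x)) = shift_map (\<phi> (Inf x))"
      using \<phi> unfolding is_conjugacy_def by blast
    also have "\<phi> (Inf x) = Inf y" using inv(2)[OF yF] x by simp
    finally have "\<psi> (shift_map (Inf y)) = \<psi> (\<phi> (shift_map (Inf x)))" by simp
    also have "\<dots> = shift_map (Inf x)"
      using xE by (intro inv) (simp add: Inf_in_edge_shift_iff infinite_paths_def)
    finally show "\<psi> (shift_map (Inf y)) = shift_map (\<psi> (Inf y))" by (simp add: x)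
  qed (rule \<psi>)
  then show thesis using inv by (rule that)
qed

section \<open>Transport along a conjugacy\<close>

text \<open>These are elements of the diagonal of the algebra: for the cylinder of a nonempty path w
  one may take m = w w^*. Such an m stands in for the indicator of P.\<close>

definition masks ::
    "('v, 'e) pre_digraph \<Rightarrow> (('v, 'e) lpa_gen free_monoid \<Rightarrow>\<^sub>0 'k::field) \<Rightarrow> ((nat \<Rightarrow> 'e) \<Rightarrow> bool) \<Rightarrow> bool"
  where
  "masks E m P \<longleftrightarrow> m \<in> free_algebra (lpa_gens E) \<and>
     (\<forall>\<xi>. \<forall>x\<in>infinite_paths E. \<forall>n. lpa_rep E m \<xi> (x, n) = (if P x then \<xi> (x, n) else 0))"

lemma lpa_gen_free_algebra:
  "v \<in> verts E \<Longrightarrow> gen (Vertex v) \<in> free_algebra (lpa_gens E)"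
  "e \<in> arcs E \<Longrightarrow> gen (Edge e) \<in> free_algebra (lpa_gens E)"
  "e \<in> arcs E \<Longrightarrow> gen (Ghost e) \<in> free_algebra (lpa_gens E)"
  by (auto simp: lpa_gens_def intro!: free_algebra_gen)

lemma masks_cong:
  "masks E m P \<Longrightarrow> (\<And>x. x \<in> infinite_paths E \<Longrightarrow> P x \<longleftrightarrow> Q x) \<Longrightarrow> masks E m Q"
  by (simp add: masks_def)

lemma masks_zero: "masks E 0 (\<lambda>_. False)"
  by (simp add: masks_def free_algebra_zero)

lemma masks_mult: "masks E m P \<Longrightarrow> masks E m' Q \<Longrightarrow> masks E (m * m') (\<lambda>x. P x \<and> Q x)"
  by (auto simp: masks_def lpa_rep_mult free_algebra_mult)

lemma masks_diff: "masks E m P \<Longrightarrow> masks E m' Q \<Longrightarrow>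
    (\<And>x. x \<in> infinite_paths E \<Longrightarrow> Q x \<Longrightarrow> P x) \<Longrightarrow> masks E (m - m') (\<lambda>x. P x \<and> \<not> Q x)"
  using free_algebra_add[of m _ "scale (- 1) m'"] free_algebra_scale[of m' _ "- 1"]
  by (auto simp: masks_def scale_uminus_one)

text \<open>Different first edges make the sets disjoint, so the indicators add up to an
  indicator.\<close>

lemma masks_sum:
  fixes m :: "'e \<Rightarrow> ('v, 'e) lpa_gen free_monoid \<Rightarrow>\<^sub>0 'k::field"
  assumes "finite A" "\<And>i. i \<in> A \<Longrightarrow> masks E (m i) (\<lambda>x. P x \<and> x 0 = i)"
  shows "masks E (\<Sum>i\<in>A. m i) (\<lambda>x. P x \<and> x 0 \<in> A)"
  unfolding masks_def
proof (intro conjI allI ballI)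
  show "(\<Sum>i\<in>A. m i) \<in> free_algebra (lpa_gens E)"
    using assms by (intro free_algebra_sum) (auto simp: masks_def)
  fix \<xi> :: "(nat \<Rightarrow> 'e) \<times> int \<Rightarrow> 'k" and x n
  assume x: "x \<in> infinite_paths E"
  have "(\<Sum>i\<in>A. lpa_rep E (m i) \<xi> (x, n)) =
      (\<Sum>i\<in>A. if i = x 0 then (if P x then \<xi> (x, n) else 0) else 0)"
    using assms(2) x by (intro sum.cong) (auto simp: masks_def)
  then show "lpa_rep E (\<Sum>i\<in>A. m i) \<xi> (x, n) = (if P x \<and> x 0 \<in> A then \<xi> (x, n) else 0)"
    using assms(1) by simp
qed

lemma masks_first_edge:
  assumes "e \<in> arcs E"
  shows "masks E (gen (Edge e) * gen (Ghost e)) (\<lambda>x. x 0 = e)"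
  using assms
  by (auto simp: masks_def lpa_rep_mult intro!: free_algebra_mult lpa_gen_free_algebra)

text \<open>Conjugating the element for w by e gives the one for e w. The recursion starts at e e^*,
  as the empty word would call for a unit.\<close>

lemma ex_masks_cylinder:
  fixes E :: "('v, 'e) pre_digraph"
  assumes "w \<noteq> []" "set w \<subseteq> arcs E"
  shows "\<exists>m :: _ \<Rightarrow>\<^sub>0 'k::field. masks E m (\<lambda>x. starts_with w (Inf x))"
  using assms
proof (induction w rule: list_nonempty_induct)
  case (single e)
  then show ?case
    using masks_first_edge[of e E] by auto
next
  case (cons e w)
  then obtain m :: "_ \<Rightarrow>\<^sub>0 'k" where m: "masks E m (\<lambda>x. starts_with w (Inf x))"
    by (auto simp del: starts_with.simps)
  have "masks E (gen (Edge e) * m * gen (Ghost e)) (\<lambda>x. starts_with (e # w) (Inf x))"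
    unfolding masks_def starts_with_Cons_Inf
  proof (intro conjI allI ballI)
    show "gen (Edge e) * m * gen (Ghost e) \<in> free_algebra (lpa_gens E)"
      using m cons by (auto simp: masks_def intro!: free_algebra_mult lpa_gen_free_algebra)
    fix \<xi> :: "(nat \<Rightarrow> 'e) \<times> int \<Rightarrow> 'k" and x n
    assume x: "x \<in> infinite_paths E"
    then have "lpa_rep E m \<eta> (\<lambda>i. x (Suc i), k) =
        (if starts_with w (Inf (\<lambda>i. x (Suc i))) then \<eta> (\<lambda>i. x (Suc i), k) else 0)" for \<eta> k
      using m infinite_paths_shift[OF x] by (auto simp: masks_def)
    then show "lpa_rep E (gen (Edge e) * m * gen (Ghost e)) \<xi> (x, n) =
        (if x 0 = e \<and> starts_with w (Inf (\<lambda>i. x (Suc i))) then \<xi> (x, n) else 0)"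
      using x by (auto simp: lpa_rep_mult)
  qed
  then show ?case by blast
qed

text \<open>The first edge is fixed to make complements available, since e e^* is a unit for the
  paths that begin with e. The sets whose trace on every first-edge cylinder is represented form a
  Boolean algebra that contains all cylinders, so \<open>clopen_in_separating_algebra\<close>
  applies.\<close>

lemma ex_masks_clopen:
  assumes C: "openin (edge_shift_topology E) C" "closedin (edge_shift_topology E) C"
    and e: "e \<in> arcs E"
  shows "\<exists>m :: _ \<Rightarrow>\<^sub>0 'k::field. masks E m (\<lambda>x. Inf x \<in> C \<and> x 0 = e)"
proof -
  let ?T = "edge_shift_topology E"
  define \<B> where "\<B> = {B. openin ?T B \<and> closedin ?T B \<and>
    (\<forall>e\<in>arcs E. \<exists>m :: _ \<Rightarrow>\<^sub>0 'k. masks E m (\<lambda>x. Inf x \<in> B \<and> x 0 = e))}"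
  have cyl: "{x \<in> edge_shift E. starts_with w x} \<in> \<B>" if w: "set w \<subseteq> arcs E" for w
  proof -
    have "\<exists>m :: _ \<Rightarrow>\<^sub>0 'k. masks E m (\<lambda>x. Inf x \<in> {x \<in> edge_shift E. starts_with w x} \<and> x 0 = e)"
      if e: "e \<in> arcs E" for e
    proof (cases w)
      case Nil
      have "masks E (gen (Edge e) * gen (Ghost e) :: _ \<Rightarrow>\<^sub>0 'k)
          (\<lambda>x. Inf x \<in> {x \<in> edge_shift E. starts_with w x} \<and> x 0 = e)"
        by (rule masks_cong[OF masks_first_edge[OF e]]) (simp add: Nil Inf_in_edge_shift_iff)
      then show ?thesis by blast
    next
      case (Cons a w')
      then obtain m :: "_ \<Rightarrow>\<^sub>0 'k" where m: "masks E m (\<lambda>x. starts_with w (Inf x))"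
        using ex_masks_cylinder[of w E] w by auto
      show ?thesis
      proof (cases "a = e")
        case True
        have "masks E m (\<lambda>x. Inf x \<in> {x \<in> edge_shift E. starts_with w x} \<and> x 0 = e)"
          by (rule masks_cong[OF m])
            (auto simp: Cons True Inf_in_edge_shift_iff starts_with_Cons_Inf simp del: starts_with.simps)
        then show ?thesis by blast
      next
        case False
        have "masks E (0 :: _ \<Rightarrow>\<^sub>0 'k) (\<lambda>x. Inf x \<in> {x \<in> edge_shift E. starts_with w x} \<and> x 0 = e)"
          by (rule masks_cong[OF masks_zero])
            (use False in \<open>auto simp: Cons starts_with_Cons_Inf simp del: starts_with.simps\<close>)
        then show ?thesis by blast
      qed
    qed
    then show ?thesis
      using clopen_cylinder_edge_shift[OF w] by (simp add: \<B>_def)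
  qed
  have "C \<in> \<B>"
  proof (rule clopen_in_separating_algebra[OF compact_space_edge_shift_topology[of E]])
    show "openin ?T S" if "S \<in> \<B>" for S
      using that by (simp add: \<B>_def)
    show "topspace ?T \<in> \<B>"
      using cyl[of "[]"] by simp
    show "topspace ?T - S \<in> \<B>" if S: "S \<in> \<B>" for S
    proof -
      have "\<exists>m :: _ \<Rightarrow>\<^sub>0 'k. masks E m (\<lambda>x. Inf x \<in> topspace ?T - S \<and> x 0 = e)"
        if e: "e \<in> arcs E" for e
      proof -
        obtain m :: "_ \<Rightarrow>\<^sub>0 'k" where m: "masks E m (\<lambda>x. Inf x \<in> S \<and> x 0 = e)"
          using S e by (auto simp: \<B>_def)
        \<comment> \<open>The complement is taken inside the cylinder of e.\<close>
        have "masks E (gen (Edge e) * gen (Ghost e) - m) (\<lambda>x. Inf x \<in> topspace ?T - S \<and> x 0 = e)"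
          by (rule masks_cong[OF masks_diff[OF masks_first_edge[OF e] m]])
            (auto simp: Inf_in_edge_shift_iff)
        then show ?thesis by blast
      qed
      then show ?thesis
        using S openin_diff[of ?T "topspace ?T" S] closedin_diff[of ?T "topspace ?T" S]
          openin_topspace[of ?T] closedin_topspace[of ?T]
        by (simp add: \<B>_def)
    qed
    show "S \<inter> T \<in> \<B>" if S: "S \<in> \<B>" and T: "T \<in> \<B>" for S T
    proof -
      have "\<exists>m :: _ \<Rightarrow>\<^sub>0 'k. masks E m (\<lambda>x. Inf x \<in> S \<inter> T \<and> x 0 = e)"
        if e: "e \<in> arcs E" for e
      proof -
        obtain m :: "_ \<Rightarrow>\<^sub>0 'k" where m: "masks E m (\<lambda>x. Inf x \<in> S \<and> x 0 = e)"
          using S e by (auto simp: \<B>_def)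
        obtain m' :: "_ \<Rightarrow>\<^sub>0 'k" where m': "masks E m' (\<lambda>x. Inf x \<in> T \<and> x 0 = e)"
          using T e by (auto simp: \<B>_def)
        from masks_mult[OF m m'] have "masks E (m * m') (\<lambda>x. Inf x \<in> S \<inter> T \<and> x 0 = e)"
          by (rule masks_cong) auto
        then show ?thesis by blast
      qed
      then show ?thesis
        using S T by (auto simp: \<B>_def)
    qed
    show "\<exists>S\<in>\<B>. x \<in> S \<longleftrightarrow> y \<notin> S" if xy: "x \<in> topspace ?T" "y \<in> topspace ?T" "x \<noteq> y" for x y
    proof -
      obtain w where "set w \<subseteq> arcs E" "starts_with w x \<longleftrightarrow> \<not> starts_with w y"
        using starts_with_separates[of x "arcs E" y] edge_shift_subset_full_shift[of E] xy by auto
      then show ?thesis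
        using xy by (intro bexI[OF _ cyl[of w]]) auto
    qed
  qed (use C in auto)
  then show ?thesis using e by (simp add: \<B>_def)
qed

text \<open>Preservation of length keeps the empty sequence out of the clopen set in question; this is
  why finitely many first edges suffice.\<close>

lemma ex_masks_first_image_edge:
  assumes \<phi>: "is_conjugacy E F \<phi>" and f: "f \<in> arcs F"
  shows "\<exists>G (m :: _ \<Rightarrow>\<^sub>0 'k::field). finite G \<and> G \<subseteq> arcs E \<and>
    (\<forall>x\<in>infinite_paths E. starts_with [f] (\<phi> (Inf x)) \<longrightarrow> x 0 \<in> G) \<and>
    masks E m (\<lambda>x. starts_with [f] (\<phi> (Inf x)))"
proof -
  let ?T = "edge_shift_topology E"
  let ?Z = "{y \<in> edge_shift F. starts_with [f] y}"
  define C where "C = {x \<in> edge_shift E. \<phi> x \<in> ?Z}"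
  have cont: "continuous_map ?T (edge_shift_topology F) \<phi>"
    using \<phi> by (simp add: is_conjugacy_def)
  have C: "openin ?T C" "closedin ?T C"
    using openin_continuous_map_preimage[OF cont, of ?Z] closedin_continuous_map_preimage[OF cont, of ?Z]
      clopen_cylinder_edge_shift[of "[f]" F] f by (auto simp: C_def)
  define cyl where "cyl e = {x \<in> edge_shift E. starts_with [e] x}" for e
  have "compactin ?T C"
    using C by (intro closedin_compact_space compact_space_edge_shift_topology)
  moreover have "openin ?T U" if "U \<in> cyl ` arcs E" for U
    using that clopen_cylinder_edge_shift[of "[_]" E] by (auto simp: cyl_def)
  moreover have "C \<subseteq> \<Union>(cyl ` arcs E)"
  proof
    fix x assume x: "x \<in> C"
    then have xE: "x \<in> edge_shift E" and fx: "starts_with [f] (\<phi> x)"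
      by (auto simp: C_def)
    then have len: "seq_length x = seq_length (\<phi> x)"
      using \<phi> by (simp add: is_conjugacy_def)
    have "\<exists>e. starts_with [e] x \<and> e \<in> arcs E"
    proof (cases x)
      case (Fin v)
      with len fx have "v \<noteq> []"
        by (cases "\<phi> x") (auto simp: zero_enat_def[symmetric])
      moreover have "set v \<subseteq> arcs E"
        using xE edge_shift_subset_full_shift[of E] Fin by (auto simp: full_shift_def split: if_splits)
      ultimately show ?thesis
        unfolding Fin by (intro exI[of _ "hd v"]) (cases v; auto)
    next
      case (Inf u)
      with xE have "u 0 \<in> arcs E"
        by (auto simp: Inf_in_edge_shift_iff infinite_paths_def)
      with Inf show ?thesis by auto
    qed
    then show "x \<in> \<Union>(cyl ` arcs E)"
      using xE by (auto simp: cyl_def)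
  qed
  ultimately obtain \<F> where "finite \<F>" "\<F> \<subseteq> cyl ` arcs E" "C \<subseteq> \<Union>\<F>"
    using compactinD[of ?T C "cyl ` arcs E"] by blast
  then obtain G where G: "finite G" "G \<subseteq> arcs E" "C \<subseteq> \<Union>(cyl ` G)"
    by (metis finite_subset_image)
  have "\<forall>e\<in>G. \<exists>m :: _ \<Rightarrow>\<^sub>0 'k. masks E m (\<lambda>x. Inf x \<in> C \<and> x 0 = e)"
    using G by (intro ballI ex_masks_clopen[OF C]) auto
  from bchoice[OF this] obtain m :: "_ \<Rightarrow> _ \<Rightarrow>\<^sub>0 'k"
    where m: "\<And>e. e \<in> G \<Longrightarrow> masks E (m e) (\<lambda>x. Inf x \<in> C \<and> x 0 = e)" by blast
  have mem: "Inf x \<in> C \<longleftrightarrow> starts_with [f] (\<phi> (Inf x))" if "x \<in> infinite_paths E" for x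
  proof -
    have "\<phi> (Inf x) \<in> edge_shift F"
      using infinite_paths_conjugacy[OF \<phi> that] by (auto simp: Inf_in_edge_shift_iff)
    then show ?thesis
      by (simp add: C_def Inf_in_edge_shift_iff that)
  qed
  have first: "x 0 \<in> G" if "Inf x \<in> C" for x
    using G(3) that by (fastforce simp: cyl_def)
  have "masks E (\<Sum>e\<in>G. m e) (\<lambda>x. starts_with [f] (\<phi> (Inf x)))"
    by (rule masks_cong[OF masks_sum[OF G(1) m]]) (use mem first in auto)
  moreover have "\<forall>x\<in>infinite_paths E. starts_with [f] (\<phi> (Inf x)) \<longrightarrow> x 0 \<in> G"
    using mem first by blast
  ultimately show ?thesis
    using G(1,2) by blast
qed

text \<open>Testing \<open>\<xi>\<close> and \<open>\<eta>\<close> on infinite paths only makes the relation compatible with products.\<close>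

definition intertwined ::
    "('v, 'e) pre_digraph \<Rightarrow> ('w, 'f) pre_digraph \<Rightarrow> ((nat \<Rightarrow> 'e) \<Rightarrow> (nat \<Rightarrow> 'f)) \<Rightarrow>
     (('v, 'e) lpa_gen free_monoid \<Rightarrow>\<^sub>0 'k::field) \<Rightarrow> (('w, 'f) lpa_gen free_monoid \<Rightarrow>\<^sub>0 'k) \<Rightarrow> bool" where
  "intertwined E F \<theta> a b \<longleftrightarrow> a \<in> free_algebra (lpa_gens E) \<and> b \<in> free_algebra (lpa_gens F) \<and>
     (\<forall>\<xi> \<eta>. (\<forall>x\<in>infinite_paths E. \<forall>n. \<xi> (x, n) = \<eta> (\<theta> x, n)) \<longrightarrow>
        (\<forall>x\<in>infinite_paths E. \<forall>n. lpa_rep E a \<xi> (x, n) = lpa_rep F b \<eta> (\<theta> x, n)))"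

lemma intertwinedI:
  fixes a :: "('v, 'e) lpa_gen free_monoid \<Rightarrow>\<^sub>0 'k::field"
    and b :: "('w, 'f) lpa_gen free_monoid \<Rightarrow>\<^sub>0 'k"
  assumes "a \<in> free_algebra (lpa_gens E)" "b \<in> free_algebra (lpa_gens F)"
    and "\<And>(\<xi> :: (nat \<Rightarrow> 'e) \<times> int \<Rightarrow> 'k) (\<eta> :: (nat \<Rightarrow> 'f) \<times> int \<Rightarrow> 'k) x n.
      (\<And>x n. x \<in> infinite_paths E \<Longrightarrow> \<xi> (x, n) = \<eta> (\<theta> x, n)) \<Longrightarrow> x \<in> infinite_paths E \<Longrightarrow>
      lpa_rep E a \<xi> (x, n) = lpa_rep F b \<eta> (\<theta> x, n)"
  shows "intertwined E F \<theta> a b"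
  using assms unfolding intertwined_def by blast

lemma intertwined_free_algebra:
  "intertwined E F \<theta> a b \<Longrightarrow> a \<in> free_algebra (lpa_gens E)"
  "intertwined E F \<theta> a b \<Longrightarrow> b \<in> free_algebra (lpa_gens F)"
  by (simp_all add: intertwined_def)

lemma intertwinedD:
  "intertwined E F \<theta> a b \<Longrightarrow> (\<And>x n. x \<in> infinite_paths E \<Longrightarrow> \<xi> (x, n) = \<eta> (\<theta> x, n)) \<Longrightarrow>
    x \<in> infinite_paths E \<Longrightarrow> lpa_rep E a \<xi> (x, n) = lpa_rep F b \<eta> (\<theta> x, n)"
  unfolding intertwined_def by blast

lemma intertwined_add:
  fixes a a' :: "('v, 'e) lpa_gen free_monoid \<Rightarrow>\<^sub>0 'k::field"
    and b b' :: "('w, 'f) lpa_gen free_monoid \<Rightarrow>\<^sub>0 'k"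
  assumes ab: "intertwined E F \<theta> a b" and ab': "intertwined E F \<theta> a' b'"
  shows "intertwined E F \<theta> (a + a') (b + b')"
proof (rule intertwinedI)
  fix \<xi> :: "(nat \<Rightarrow> 'e) \<times> int \<Rightarrow> 'k" and \<eta> :: "(nat \<Rightarrow> 'f) \<times> int \<Rightarrow> 'k" and x n
  assume eq: "\<And>x n. x \<in> infinite_paths E \<Longrightarrow> \<xi> (x, n) = \<eta> (\<theta> x, n)" and x: "x \<in> infinite_paths E"
  show "lpa_rep E (a + a') \<xi> (x, n) = lpa_rep F (b + b') \<eta> (\<theta> x, n)"
    using intertwinedD[of E F \<theta> a b \<xi> \<eta>, OF ab eq x] intertwinedD[of E F \<theta> a' b' \<xi> \<eta>, OF ab' eq x]
    by simp
qed (use assms in \<open>auto intro: free_algebra_add dest: intertwined_free_algebra\<close>)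

lemma intertwined_mult:
  fixes a a' :: "('v, 'e) lpa_gen free_monoid \<Rightarrow>\<^sub>0 'k::field"
    and b b' :: "('w, 'f) lpa_gen free_monoid \<Rightarrow>\<^sub>0 'k"
  assumes ab: "intertwined E F \<theta> a b" and ab': "intertwined E F \<theta> a' b'"
  shows "intertwined E F \<theta> (a * a') (b * b')"
proof (rule intertwinedI)
  fix \<xi> :: "(nat \<Rightarrow> 'e) \<times> int \<Rightarrow> 'k" and \<eta> :: "(nat \<Rightarrow> 'f) \<times> int \<Rightarrow> 'k" and x n
  assume eq: "\<And>x n. x \<in> infinite_paths E \<Longrightarrow> \<xi> (x, n) = \<eta> (\<theta> x, n)" and x: "x \<in> infinite_paths E"
  show "lpa_rep E (a * a') \<xi> (x, n) = lpa_rep F (b * b') \<eta> (\<theta> x, n)"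
    unfolding lpa_rep_mult
    by (rule intertwinedD[OF ab _ x], rule intertwinedD[OF ab'], rule eq)
qed (use assms in \<open>auto intro: free_algebra_mult dest: intertwined_free_algebra\<close>)

lemma intertwined_scale:
  fixes a :: "('v, 'e) lpa_gen free_monoid \<Rightarrow>\<^sub>0 'k::field"
    and b :: "('w, 'f) lpa_gen free_monoid \<Rightarrow>\<^sub>0 'k"
  assumes ab: "intertwined E F \<theta> a b"
  shows "intertwined E F \<theta> (scale c a) (scale c b)"
proof (rule intertwinedI)
  fix \<xi> :: "(nat \<Rightarrow> 'e) \<times> int \<Rightarrow> 'k" and \<eta> :: "(nat \<Rightarrow> 'f) \<times> int \<Rightarrow> 'k" and x n
  assume eq: "\<And>x n. x \<in> infinite_paths E \<Longrightarrow> \<xi> (x, n) = \<eta> (\<theta> x, n)" and x: "x \<in> infinite_paths E"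
  show "lpa_rep E (scale c a) \<xi> (x, n) = lpa_rep F (scale c b) \<eta> (\<theta> x, n)"
    using intertwinedD[of E F \<theta> a b \<xi> \<eta>, OF ab eq x] by simp
qed (use assms in \<open>auto intro: free_algebra_scale dest: intertwined_free_algebra\<close>)

lemma intertwined_zero: "intertwined E F \<theta> 0 0"
  by (simp add: intertwined_def free_algebra_zero)

lemma intertwined_right_total:
  fixes E :: "('v, 'e) pre_digraph" and b :: "('w, 'f) lpa_gen free_monoid \<Rightarrow>\<^sub>0 'k::field"
  assumes \<phi>: "is_conjugacy E F \<phi>"
    and no_source: "\<And>v. v \<in> verts F \<Longrightarrow> \<exists>f\<in>arcs F. head F f = v"
    and \<theta>: "\<And>x. x \<in> infinite_paths E \<Longrightarrow> \<theta> x \<in> infinite_paths F \<and> \<phi> (Inf x) = Inf (\<theta> x)"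
    and bij: "bij_betw \<theta> (infinite_paths E) (infinite_paths F)"
    and b: "b \<in> free_algebra (lpa_gens F)"
  shows "\<exists>a. intertwined E F \<theta> a b"
proof -
  have shift: "\<theta> (\<lambda>i. x (Suc i)) = (\<lambda>i. \<theta> x (Suc i))" if "x \<in> infinite_paths E" for x
  proof -
    have "\<phi> (shift_map (Inf x)) = shift_map (\<phi> (Inf x))"
      using \<phi> that by (simp add: is_conjugacy_def)
    then show ?thesis
      using \<theta>[OF that] \<theta>[OF infinite_paths_shift[OF that]] by simp
  qed
  have edges: "\<exists>(a :: _ \<Rightarrow>\<^sub>0 'k) (a' :: _ \<Rightarrow>\<^sub>0 'k). intertwined E F \<theta> a (gen (Edge f)) \<and> intertwined E F \<theta> a' (gen (Ghost f))"
    if f: "f \<in> arcs F" for f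
  proof -
    obtain G and m :: "_ \<Rightarrow>\<^sub>0 'k" where G: "finite G" "G \<subseteq> arcs E"
      and first: "\<And>x. x \<in> infinite_paths E \<Longrightarrow> \<theta> x 0 = f \<Longrightarrow> x 0 \<in> G"
      and m: "masks E m (\<lambda>x. starts_with [f] (\<phi> (Inf x)))"
      using ex_masks_first_image_edge[OF \<phi> f] \<theta> by auto
    have m_free: "m \<in> free_algebra (lpa_gens E)"
      and m_rep: "\<And>\<xi> x n. x \<in> infinite_paths E \<Longrightarrow>
        lpa_rep E m \<xi> (x, n) = (if \<theta> x 0 = f then \<xi> (x, n) else 0)"
      using m \<theta> by (auto simp: masks_def)
    \<comment> \<open>The sum over all edges would act as the shift, but it may be infinite. The sum
      over G agrees with it wherever m does not vanish, by \<open>first\<close>.\<close>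
    have "intertwined E F \<theta> (m * (\<Sum>e\<in>G. gen (Edge e))) (gen (Edge f))"
    proof (rule intertwinedI)
      show "m * (\<Sum>e\<in>G. gen (Edge e)) \<in> free_algebra (lpa_gens E)"
        using G m_free by (intro free_algebra_mult free_algebra_sum lpa_gen_free_algebra) auto
      show "gen (Edge f) \<in> free_algebra (lpa_gens F)"
        using f by (rule lpa_gen_free_algebra)
      fix \<xi> :: "(nat \<Rightarrow> 'e) \<times> int \<Rightarrow> 'k" and \<eta> :: "(nat \<Rightarrow> 'f) \<times> int \<Rightarrow> 'k" and x n
      assume eq: "\<And>x n. x \<in> infinite_paths E \<Longrightarrow> \<xi> (x, n) = \<eta> (\<theta> x, n)" and x: "x \<in> infinite_paths E"
      have "(\<Sum>e\<in>G. lpa_op E (Edge e) \<xi> (x, n)) =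
          (\<Sum>e\<in>G. if e = x 0 then \<xi> (\<lambda>i. x (Suc i), n - 1) else 0)"
        using x by (intro sum.cong) auto
      also have "\<dots> = (if x 0 \<in> G then \<eta> (\<lambda>i. \<theta> x (Suc i), n - 1) else 0)"
        using G eq infinite_paths_shift[OF x] shift[OF x] by simp
      finally show "lpa_rep E (m * (\<Sum>e\<in>G. gen (Edge e))) \<xi> (x, n) = lpa_rep F (gen (Edge f)) \<eta> (\<theta> x, n)"
        using x \<theta>[OF x] first[OF x] by (auto simp: lpa_rep_mult m_rep)
    qed
    moreover have "intertwined E F \<theta> ((\<Sum>e\<in>G. gen (Ghost e)) * m) (gen (Ghost f))"
    proof (rule intertwinedI)
      show "(\<Sum>e\<in>G. gen (Ghost e)) * m \<in> free_algebra (lpa_gens E)"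
        using G m_free by (intro free_algebra_mult free_algebra_sum lpa_gen_free_algebra) auto
      show "gen (Ghost f) \<in> free_algebra (lpa_gens F)"
        using f by (rule lpa_gen_free_algebra)
      fix \<xi> :: "(nat \<Rightarrow> 'e) \<times> int \<Rightarrow> 'k" and \<eta> :: "(nat \<Rightarrow> 'f) \<times> int \<Rightarrow> 'k" and x n
      assume eq: "\<And>x n. x \<in> infinite_paths E \<Longrightarrow> \<xi> (x, n) = \<eta> (\<theta> x, n)" and x: "x \<in> infinite_paths E"
      let ?y = "case_nat f (\<theta> x)"
      have image: "\<theta> (case_nat e x) = ?y"
        if "case_nat e x \<in> infinite_paths E" "\<theta> (case_nat e x) 0 = f" for e
        using shift[OF that(1)] that(2) by (subst eq_commute) (simp add: case_nat_eq_iff)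
      have lhs: "lpa_rep E ((\<Sum>e\<in>G. gen (Ghost e)) * m) \<xi> (x, n) =
          (\<Sum>e\<in>G. if case_nat e x \<in> infinite_paths E \<and> \<theta> (case_nat e x) 0 = f
            then \<xi> (case_nat e x, n + 1) else 0)"
        by (auto simp: lpa_rep_mult m_rep intro!: sum.cong)
      show "lpa_rep E ((\<Sum>e\<in>G. gen (Ghost e)) * m) \<xi> (x, n) = lpa_rep F (gen (Ghost f)) \<eta> (\<theta> x, n)"
      proof (cases "?y \<in> infinite_paths F")
        case False
        then have "\<not> (case_nat e x \<in> infinite_paths E \<and> \<theta> (case_nat e x) 0 = f)" for e
          using image[of e] \<theta>[of "case_nat e x"] by auto
        then show ?thesis
          unfolding lhs using False by (subst sum.neutral) auto
      next
        case True
        \<comment> \<open>Prepending f to the image of x has to be undone by prepending one edge to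
          x. As \<theta> is injective and commutes with the shift, the tail of z is x, so exactly
          one summand contributes, namely that of \<open>z 0\<close>.\<close>
        then obtain z where z: "z \<in> infinite_paths E" "\<theta> z = ?y"
          using bij by (metis bij_betw_imp_surj_on imageE)
        then have "\<theta> (\<lambda>i. z (Suc i)) = \<theta> x"
          using shift[of z] by simp
        then have zx: "(\<lambda>i. z (Suc i)) = x"
          using bij x infinite_paths_shift[OF z(1)] by (auto simp: bij_betw_def inj_on_def)
        then have z_eq: "z = case_nat (z 0) x"
          using case_nat_shift[of z] by simp
        have "case_nat e x \<in> infinite_paths E \<and> \<theta> (case_nat e x) 0 = f \<longleftrightarrow> e = z 0" for e
        proof
          assume e: "case_nat e x \<in> infinite_paths E \<and> \<theta> (case_nat e x) 0 = f"
          then have "\<theta> (case_nat e x) = \<theta> z" using image z by simp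
          then have "case_nat e x = z"
            using bij e z by (auto simp: bij_betw_def inj_on_def)
          then show "e = z 0" by auto
        next
          assume "e = z 0"
          then have "case_nat e x = z" using z_eq by simp
          then show "case_nat e x \<in> infinite_paths E \<and> \<theta> (case_nat e x) 0 = f"
            using z by simp
        qed
        moreover have "z 0 \<in> G" using first[of z] z by simp
        ultimately have "lpa_rep E ((\<Sum>e\<in>G. gen (Ghost e)) * m) \<xi> (x, n) = \<xi> (case_nat (z 0) x, n + 1)"
          using G by (simp add: lhs)
        also have "\<dots> = \<eta> (?y, n + 1)"
          using eq z z_eq by metis
        finally show ?thesis using True by simp
      qed
    qed
    ultimately show ?thesis by blast
  qed
  have vertices: "\<exists>a :: _ \<Rightarrow>\<^sub>0 'k. intertwined E F \<theta> a (gen (Vertex v))" if v: "v \<in> verts F" for v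
  proof -
    obtain f where f: "f \<in> arcs F" "head F f = v" using no_source[OF v] by blast
    then obtain a a' :: "_ \<Rightarrow>\<^sub>0 'k" where "intertwined E F \<theta> a (gen (Edge f))" "intertwined E F \<theta> a' (gen (Ghost f))"
      using edges by blast
    from intertwined_mult[OF this(2,1)] have "intertwined E F \<theta> (a' * a) (gen (Ghost f) * gen (Edge f))" .
    \<comment> \<open>Apart from membership in the free algebra, \<open>intertwined\<close> sees
      only the operator, so f^* f may be replaced by v.\<close>
    moreover have "lpa_rep F (gen (Ghost f) * gen (Edge f)) \<eta> = lpa_rep F (gen (Vertex v)) \<eta>" for \<eta> :: "_ \<Rightarrow> 'k"
      by (rule ext, clarify) (use f in \<open>auto simp: lpa_rep_mult infinite_paths_case_nat\<close>)
    ultimately have "intertwined E F \<theta> (a' * a) (gen (Vertex v))"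
      using v by (simp add: intertwined_def lpa_gen_free_algebra)
    then show ?thesis by blast
  qed
  have gens: "\<exists>a :: _ \<Rightarrow>\<^sub>0 'k. intertwined E F \<theta> a (gen x)" if "x \<in> lpa_gens F" for x
    using that edges vertices by (auto simp: lpa_gens_def)
  show ?thesis
    using b
  proof (induction rule: free_algebra_induct)
    case zero
    show ?case using intertwined_zero by blast
  next
    case (gen x)
    then show ?case by (rule gens)
  next
    case (add f g)
    then show ?case using intertwined_add by blast
  next
    case (mult f x)
    then show ?case using intertwined_mult gens by blast
  next
    case (scale c f)
    then show ?case using intertwined_scale by blast
  qed
qed

text \<open>By faithfulness both sides say that an operator vanishes on all test functions. A test
  function on one path space becomes one on the other by composition with \<theta> or its
  inverse.\<close>

lemma intertwined_ideal:
  fixes a :: "('v, 'e) lpa_gen free_monoid \<Rightarrow>\<^sub>0 'k::field"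
    and b :: "('w, 'f) lpa_gen free_monoid \<Rightarrow>\<^sub>0 'k"
  assumes "sinkless_graph E" "sinkless_graph F" "intertwined E F \<theta> a b"
    and bij: "bij_betw \<theta> (infinite_paths E) (infinite_paths F)"
  shows "a \<in> ideal_generated (lpa_gens E) (lpa_relators E) \<longleftrightarrow>
    b \<in> ideal_generated (lpa_gens F) (lpa_relators F)"
proof -
  note a = intertwined_free_algebra(1)[OF assms(3)] and b = intertwined_free_algebra(2)[OF assms(3)]
    and eq = intertwinedD[OF assms(3)]
  have "(\<forall>\<xi>. \<forall>x\<in>infinite_paths E. \<forall>n. lpa_rep E a \<xi> (x, n) = 0) \<longleftrightarrow>
      (\<forall>\<eta>. \<forall>y\<in>infinite_paths F. \<forall>n. lpa_rep F b \<eta> (y, n) = 0)"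
  proof (intro iffI allI ballI)
    fix \<eta> :: "(nat \<Rightarrow> 'f) \<times> int \<Rightarrow> 'k" and y n
    assume "\<forall>\<xi>. \<forall>x\<in>infinite_paths E. \<forall>n. lpa_rep E a \<xi> (x, n) = 0" and "y \<in> infinite_paths F"
    moreover from this obtain x where "x \<in> infinite_paths E" "y = \<theta> x"
      using bij by (metis bij_betw_imp_surj_on imageE)
    ultimately show "lpa_rep F b \<eta> (y, n) = 0"
      using eq[of "\<lambda>(x, n). \<eta> (\<theta> x, n)" \<eta> x n] by simp
  next
    fix \<xi> :: "(nat \<Rightarrow> 'e) \<times> int \<Rightarrow> 'k" and x n
    assume "\<forall>\<eta>. \<forall>y\<in>infinite_paths F. \<forall>n. lpa_rep F b \<eta> (y, n) = 0" and x: "x \<in> infinite_paths E"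
    moreover have "\<theta> x \<in> infinite_paths F"
      using bij x by (auto simp: bij_betw_def)
    moreover have "inv_into (infinite_paths E) \<theta> (\<theta> x) = x" if "x \<in> infinite_paths E" for x
      using bij that by (simp add: bij_betw_def)
    ultimately show "lpa_rep E a \<xi> (x, n) = 0"
      using eq[of \<xi> "\<lambda>(y, n). \<xi> (inv_into (infinite_paths E) \<theta> y, n)" x n] by simp
  qed
  then show ?thesis
    using sinkless_graph.lpa_rep_faithful[OF assms(1) a] sinkless_graph.lpa_rep_faithful[OF assms(2) b]
    by simp
qed

theorem theorem8p11:
  fixes E :: "('v, 'e) pre_digraph" and F :: "('w, 'f) pre_digraph"
  assumes "countable_graph E" and "countable_graph F"
    and "\<nexists>v. is_sink E v" and "\<nexists>v. is_source E v"
    and "\<nexists>v. is_sink F v" and "\<nexists>v. is_source F v"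
    and "edge_shifts_conjugate E F"
  shows "algebras_isomorphic
           (leavitt_path_algebra E :: (complex, (('v, 'e) lpa_gen free_monoid \<Rightarrow>\<^sub>0 complex) set) field_algebra)
           (leavitt_path_algebra F :: (complex, (('w, 'f) lpa_gen free_monoid \<Rightarrow>\<^sub>0 complex) set) field_algebra)"
proof -
  have E: "sinkless_graph E" and F: "sinkless_graph F"
    using assms by (auto simp: sinkless_graph_def countable_graph_def is_sink_def)
  have sources: "v \<in> verts E \<Longrightarrow> \<exists>e\<in>arcs E. head E e = v" "w \<in> verts F \<Longrightarrow> \<exists>f\<in>arcs F. head F f = w" for v w
    using assms by (auto simp: is_source_def)
  obtain \<phi> where \<phi>: "is_conjugacy E F \<phi>"
    using assms(7) unfolding edge_shifts_conjugate_def is_conjugacy_def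
    by (metis Inf_in_edge_shift_iff)
  then obtain \<psi> where \<psi>: "is_conjugacy F E \<psi>" and inv: "\<And>x. x \<in> edge_shift E \<Longrightarrow> \<psi> (\<phi> x) = x"
    "\<And>y. y \<in> edge_shift F \<Longrightarrow> \<phi> (\<psi> y) = y"
    using is_conjugacy_inverse by blast
  obtain \<theta> where \<theta>: "\<And>x. x \<in> infinite_paths E \<Longrightarrow> \<theta> x \<in> infinite_paths F \<and> \<phi> (Inf x) = Inf (\<theta> x)"
    using infinite_paths_conjugacy[OF \<phi>] by metis
  obtain \<theta>' where \<theta>': "\<And>y. y \<in> infinite_paths F \<Longrightarrow> \<theta>' y \<in> infinite_paths E \<and> \<psi> (Inf y) = Inf (\<theta>' y)"
    using infinite_paths_conjugacy[OF \<psi>] by metis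
  have inv1: "\<theta>' (\<theta> x) = x" if "x \<in> infinite_paths E" for x
    using inv(1)[of "Inf x"] \<theta>[OF that] \<theta>'[of "\<theta> x"] that by (simp add: Inf_in_edge_shift_iff)
  have inv2: "\<theta> (\<theta>' y) = y" if "y \<in> infinite_paths F" for y
    using inv(2)[of "Inf y"] \<theta>'[OF that] \<theta>[of "\<theta>' y"] that by (simp add: Inf_in_edge_shift_iff)
  have bij: "bij_betw \<theta> (infinite_paths E) (infinite_paths F)"
    by (rule bij_betw_byWitness[where f' = \<theta>']) (use inv1 inv2 \<theta> \<theta>' in auto)
  have bij': "bij_betw \<theta>' (infinite_paths F) (infinite_paths E)"
    by (rule bij_betw_byWitness[where f' = \<theta>]) (use inv1 inv2 \<theta> \<theta>' in auto)
  show ?thesis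
    unfolding leavitt_path_algebra_def
  proof (rule presented_algebras_isomorphic_if_relation[where \<rho> = "intertwined E F \<theta>"])
    show "\<exists>b. intertwined E F \<theta> a b" if a: "a \<in> free_algebra (lpa_gens E)" for a :: "_ \<Rightarrow>\<^sub>0 complex"
    proof -
      obtain b where b: "intertwined F E \<theta>' b a"
        using intertwined_right_total[OF \<psi> sources(1) \<theta>' bij' a] by blast
      \<comment> \<open>Turning the relation around is possible because \<theta> and \<theta>' are
        mutually inverse on infinite paths, where alone the test functions are compared.\<close>
      have "intertwined E F \<theta> a b"
      proof (rule intertwinedI)
        fix \<xi> :: "(nat \<Rightarrow> 'e) \<times> int \<Rightarrow> complex" and \<eta> :: "(nat \<Rightarrow> 'f) \<times> int \<Rightarrow> complex" and x n
        assume eq: "\<And>x n. x \<in> infinite_paths E \<Longrightarrow> \<xi> (x, n) = \<eta> (\<theta> x, n)"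
          and x: "x \<in> infinite_paths E"
        have "\<eta> (y, n) = \<xi> (\<theta>' y, n)" if "y \<in> infinite_paths F" for y n
          using eq[of "\<theta>' y"] \<theta>'[OF that] inv2[OF that] by simp
        then have "lpa_rep F b \<eta> (\<theta> x, n) = lpa_rep E a \<xi> (\<theta>' (\<theta> x), n)"
          using \<theta>[OF x] by (intro intertwinedD[OF b]) auto
        then show "lpa_rep E a \<xi> (x, n) = lpa_rep F b \<eta> (\<theta> x, n)"
          using inv1[OF x] by simp
      qed (use b in \<open>auto simp: intertwined_def\<close>)
      then show ?thesis by blast
    qed
    show "\<exists>a. intertwined E F \<theta> a b" if "b \<in> free_algebra (lpa_gens F)" for b :: "_ \<Rightarrow>\<^sub>0 complex"
      using intertwined_right_total[OF \<phi> sources(2) \<theta> bij that] by blast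
  qed (auto intro: intertwined_add intertwined_mult intertwined_scale
      simp: intertwined_ideal[OF E F _ bij], auto simp: intertwined_def)
qed

end
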